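(* Let $\mathcal{D}$ be any probability distribution over pairs $(x,y)$ with $x\in\mathcal{X}$ and $y\in\mathcal{Y}(x)$, let $m\ge 1$, $\delta\in(0,1)$, and let $\beta=\beta(m,w)>0$ be any scale parameter, possibly depending on $m$ and $w$. With probability at least $1-\delta$ over a sample $S=\{(x_i,y_i)\}_{i=1}^m$ drawn i.i.d. from $\mathcal{D}$, simultaneously for all $w\in\mathcal{W}$: $$L(w,\mathcal{D})\le L(w,S)+2\sqrt{\frac{s(\ln d+2\ln(mr))}{m}}+3\sqrt{\frac{\ln(2/\delta)}{2m}}.$$
   Context: Setting: $\mathcal{X}$ is an input space; for each $x\in\mathcal{X}$, $\mathcal{Y}(x)$ is a finite nonempty set of structured outputs with $|\mathcal{Y}(x)|\le r$. A joint feature map $\phi(x,y)\in\mathbb{R}^d$ is given, and every nonzero coordinate of every $\phi(x,y)$ is at least $1$. $\mathcal{W}$ denotes the set of $s$-sparse vectors in $\mathbb{R}^d$ (at most $s$ nonzero coordinates). $\mathcal{G}(\beta)$ is the Gumbel distribution with location $0$ and scale $\beta$ (CDF $t\mapsto\exp(-e^{-t/\beta})$). For $w\in\mathbb{R}^d$ and $\gamma=(\gamma_y)_{y\in\mathcal{Y}(x)}$ with i.i.d. $\mathcal{G}(\beta)$ entries, the stochastic decoder is $f_{w,\gamma}(x)=\arg\max_{y\in\mathcal{Y}(x)}\langle\phi(x,y),w\rangle+\gamma_y$ (ties have probability zero); equivalently $\Pr_\gamma[f_{w,\gamma}(x)=y]=\exp(\langle\phi(x,y),w\rangle/\beta)/\sum_{y'\in\mathcal{Y}(x)}\exp(\langle\phi(x,y'),w\rangle/\beta)$.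 Losses: $L(w,\mathcal{D})=\mathbb{E}_{(x,y)\sim\mathcal{D}}\Pr_\gamma[f_{w,\gamma}(x)\ne y]$ and, for $S=\{(x_i,y_i)\}_{i=1}^m$, the CRF loss $L(w,S)=\frac1m\sum_{i=1}^m\Pr_\gamma[f_{w,\gamma}(x_i)\ne y_i]$, where $\gamma$ has scale $\beta=\beta(m,w)$. *)

theory Defs
  imports "HOL-Probability.Probability"
begin

text \<open>Probability, under the Gumbel-perturbed decoder with scale b and weight w,
  that the predicted output on input x equals y (Gumbel-max / softmax form).
  Outputs outside Y x are never predicted.\<close>
definition pred_prob ::
  "('x \<Rightarrow> 'y set) \<Rightarrow> ('x \<Rightarrow> 'y \<Rightarrow> real^'d) \<Rightarrow> real \<Rightarrow> real^'d \<Rightarrow> 'x \<Rightarrow> 'y \<Rightarrow> real" where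
  "pred_prob Y \<phi> b w x y =
     (if y \<in> Y x then exp ((\<phi> x y \<bullet> w) / b) / (\<Sum>y'\<in>Y x. exp ((\<phi> x y' \<bullet> w) / b)) else 0)"

definition err ::
  "('x \<Rightarrow> 'y set) \<Rightarrow> ('x \<Rightarrow> 'y \<Rightarrow> real^'d) \<Rightarrow> real \<Rightarrow> real^'d \<Rightarrow> 'x \<times> 'y \<Rightarrow> real" where
  "err Y \<phi> b w p = 1 - pred_prob Y \<phi> b w (fst p) (snd p)"

definition pop_loss ::
  "('x \<Rightarrow> 'y set) \<Rightarrow> ('x \<Rightarrow> 'y \<Rightarrow> real^'d) \<Rightarrow> real \<Rightarrow> real^'d \<Rightarrow> ('x \<times> 'y) measure \<Rightarrow> real" where
  "pop_loss Y \<phi> b w D = (\<integral>p. err Y \<phi> b w p \<partial>D)"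

definition emp_loss ::
  "('x \<Rightarrow> 'y set) \<Rightarrow> ('x \<Rightarrow> 'y \<Rightarrow> real^'d) \<Rightarrow> real \<Rightarrow> real^'d \<Rightarrow> nat \<Rightarrow> (nat \<Rightarrow> 'x \<times> 'y) \<Rightarrow> real" where
  "emp_loss Y \<phi> b w m S = (1 / real m) * (\<Sum>i<m. err Y \<phi> b w (S i))"

definition sparse_vecs :: "nat \<Rightarrow> (real^'d) set" where
  "sparse_vecs s = {w. card {i. w $ i \<noteq> 0} \<le> s}"

end

theory Submission
  imports Defs "HOL-Real_Asymp.Real_Asymp"
begin

text \<open>
  Replacing \<open>w\<close> by \<open>v = w / \<beta>\<close>, which is again \<open>s\<close>-sparse, reduces the claim to scale 1.
  By the Gumbel-max identity the error of \<open>v\<close> at an example \<open>(x, y)\<close> is the probability, over a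
  Gumbel vector \<open>\<gamma>\<close> that does not depend on \<open>v\<close>, that some affine inequality
  \<open>\<langle>\<phi> x y' - \<phi> x y, v\<rangle> > \<gamma> y - \<gamma> y'\<close> holds. For fixed \<open>\<gamma>\<close> and \<open>2 m\<close> examples, the inequalities
  cut each of the at most \<open>d\<^sup>s\<close> coordinate subspaces into at most \<open>(2 m r + 1)\<^sup>s\<close> cells, so the 0/1 loss
  vectors number at most \<open>K = (d (2 m r + 1))\<^sup>s\<close>. Symmetrisation inside the moment
  generating function, with Jensen's inequality used both for the ghost sample and for \<open>\<gamma>\<close>, then gives
  \<open>E exp (m \<epsilon> sup (L(v, D) - L(v, S))) \<le> K exp (m \<epsilon>\<^sup>2 / 2)\<close>, and Markov's inequality yields the tail bound
  \<open>K exp (- m \<epsilon>\<^sup>2 / 2)\<close>; no bounded-difference inequality is needed. The supremum is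
  first taken over finite sets, and passes to all sparse vectors through a countable dense subset.
\<close>

section \<open>Sign patterns of affine functionals\<close>

text \<open>Induction over the functionals, with \<open>S\<close> generalised. Adding
  \<open>k\<close> splits a pattern in two only if it occurs on both sides of the hyperplane of
  \<open>k\<close>; such a pattern already occurs on the intersection of \<open>S\<close> with that
  hyperplane, one dimension lower. With \<open>n = card J\<close> and dimension
  \<open>e \<ge> 1\<close> the two counts combine by
  \<open>(n + 1) ^ e + (n + 1) ^ (e - 1) \<le> (n + 2) ^ e\<close>.\<close>

lemma card_halfspace_patterns_le:
  fixes a :: "'j \<Rightarrow> 'a::euclidean_space" and c :: "'j \<Rightarrow> real"
  assumes "finite J" "affine S"
  shows "card ((\<lambda>v. {j \<in> J. a j \<bullet> v > c j}) ` S) \<le> (card J + 1) ^ nat (aff_dim S)"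
  using assms
proof (induction J arbitrary: S rule: finite_induct)
  case empty
  have "card ((\<lambda>v. {}::'j set) ` S) \<le> card {{}::'j set}"
    by (intro card_mono) auto
  then show ?case by simp
next
  case (insert k J)
  define pat where "pat = (\<lambda>v. {j \<in> J. a j \<bullet> v > c j})"
  define pat' where "pat' = (\<lambda>v. {j \<in> insert k J. a j \<bullet> v > c j})"
  define H where "H = {v. a k \<bullet> v = c k}"
  have k: "k \<notin> J" by fact
  have fin: "finite (pat ` A)" for A
    by (rule finite_subset[of _ "Pow J"]) (use insert in \<open>auto simp: pat_def\<close>)
  have pat'_eq: "pat' v = (if a k \<bullet> v > c k then insert k (pat v) else pat v)" for v
    by (auto simp: pat_def pat'_def)
  define Pos where "Pos = pat ` (S \<inter> {v. a k \<bullet> v > c k})"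
  define Neg where "Neg = pat ` (S \<inter> {v. a k \<bullet> v \<le> c k})"
  have "pat' ` S \<subseteq> insert k ` Pos \<union> Neg"
    by (auto simp: pat'_eq Pos_def Neg_def)
  then have "card (pat' ` S) \<le> card (insert k ` Pos \<union> Neg)"
    by (intro card_mono) (auto simp: Pos_def Neg_def fin)
  also have "\<dots> \<le> card (insert k ` Pos) + card Neg"
    by (rule card_Un_le)
  also have "\<dots> \<le> card Pos + card Neg"
    using card_image_le[of Pos "insert k"] fin by (simp add: Pos_def)
  also have "\<dots> = card (Pos \<union> Neg) + card (Pos \<inter> Neg)"
    by (rule card_Un_Int) (auto simp: Pos_def Neg_def fin)
  also have "Pos \<union> Neg = pat ` S"
    unfolding Pos_def Neg_def image_Un[symmetric] by (rule arg_cong[where f = "image pat"]) auto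
  finally have le: "card (pat' ` S) \<le> card (pat ` S) + card (Pos \<inter> Neg)" .
  \<comment> \<open>A pattern realised on both sides of the hyperplane \<open>H\<close> is, by convexity, realised on \<open>H\<close>.\<close>
  have cross: "Pos \<inter> Neg \<subseteq> pat ` (S \<inter> H)"
  proof
    fix P assume "P \<in> Pos \<inter> Neg"
    then obtain u w where u: "u \<in> S" "a k \<bullet> u > c k" "P = pat u"
      and w: "w \<in> S" "a k \<bullet> w \<le> c k" "P = pat w"
      by (auto simp: Pos_def Neg_def)
    \<comment> \<open>The segment from \<open>w\<close> to \<open>u\<close> meets the hyperplane at
      parameter \<open>t\<close>. Since \<open>u\<close> lies strictly above it,
      \<open>t < 1\<close>, so \<open>w\<close> keeps a positive weight and strict inequalities
      valid at both ends survive.\<close>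
    define t where "t = (c k - a k \<bullet> w) / (a k \<bullet> u - a k \<bullet> w)"
    have t: "0 \<le> t" "t < 1" using u w by (auto simp: t_def)
    define v where "v = (1 - t) *\<^sub>R w + t *\<^sub>R u"
    have inner_v: "b \<bullet> v = (1 - t) * (b \<bullet> w) + t * (b \<bullet> u)" for b
      by (simp add: v_def inner_add_right)
    have "t * (a k \<bullet> u - a k \<bullet> w) = c k - a k \<bullet> w"
      using u w by (simp add: t_def)
    then have "v \<in> H"
      by (simp add: H_def inner_v algebra_simps)
    moreover have "v \<in> S"
      using insert.prems u w by (simp add: v_def mem_affine)
    moreover have "pat v = P"
    proof -
      have "a j \<bullet> v > c j \<longleftrightarrow> a j \<bullet> w > c j" if "j \<in> J" for j
      proof -
        have same: "a j \<bullet> u > c j \<longleftrightarrow> a j \<bullet> w > c j"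
          using that u(3) w(3) by (auto simp: pat_def)
        have eq: "a j \<bullet> v - c j = (1 - t) * (a j \<bullet> w - c j) + t * (a j \<bullet> u - c j)"
          by (simp add: inner_v algebra_simps)
        show ?thesis
        proof (cases "a j \<bullet> w > c j")
          case True
          then have "0 < (1 - t) * (a j \<bullet> w - c j)" "0 \<le> t * (a j \<bullet> u - c j)"
            using same t by auto
          with True eq show ?thesis by linarith
        next
          case False
          then have "(1 - t) * (a j \<bullet> w - c j) \<le> 0" "t * (a j \<bullet> u - c j) \<le> 0"
            using same t by (auto simp: mult_le_0_iff)
          with False eq show ?thesis by linarith
        qed
      qed
      then show ?thesis by (auto simp: w(3) pat_def)
    qed
    ultimately show "P \<in> pat ` (S \<inter> H)" by blast
  qed
  have IH: "card (pat ` T) \<le> (card J + 1) ^ nat (aff_dim T)" if "affine T" for T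
    using insert.IH[OF that] by (simp add: pat_def)
  have card_k: "card (insert k J) = card J + 1" using insert by simp
  show ?case
  proof (cases "Pos \<inter> Neg = {}")
    case True
    then have "card (pat' ` S) \<le> (card J + 1) ^ nat (aff_dim S)"
      using le IH[OF insert.prems] by simp
    also have "\<dots> \<le> (card (insert k J) + 1) ^ nat (aff_dim S)"
      using card_k by (intro power_mono) auto
    finally show ?thesis by (simp add: pat'_def)
  next
    case False
    with cross have ne: "S \<inter> H \<noteq> {}" by auto
    \<comment> \<open>A pattern in \<open>Pos\<close> comes from a point of \<open>S\<close> off
      \<open>H\<close>, so the cut lowers the dimension by exactly one; as the cut is nonempty,
      \<open>nat\<close> truncates nothing.\<close>
    have nsub: "\<not> S \<subseteq> H" using False by (auto simp: Pos_def H_def)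
    have dimH: "aff_dim (S \<inter> H) = aff_dim S - 1"
      using aff_dim_affine_Int_hyperplane[OF insert.prems, of "a k" "c k"] ne nsub by (simp add: H_def)
    have affH: "affine (S \<inter> H)"
      unfolding H_def by (intro affine_Int insert.prems affine_hyperplane)
    have "aff_dim (S \<inter> H) \<ge> 0"
      using ne by (metis aff_dim_negative_iff not_less)
    then obtain n where n: "nat (aff_dim S) = Suc n" "nat (aff_dim (S \<inter> H)) = n"
      using dimH by (metis Suc_nat_eq_nat_zadd1 diff_add_cancel add.commute)
    have "card (Pos \<inter> Neg) \<le> card (pat ` (S \<inter> H))"
      by (intro card_mono fin cross)
    also have "\<dots> \<le> (card J + 1) ^ n"
      using IH[OF affH] n by simp
    finally have "card (pat' ` S) \<le> (card J + 1) ^ Suc n + (card J + 1) ^ n"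
      using le IH[OF insert.prems] n by simp
    also have "\<dots> = (card J + 2) * (card J + 1) ^ n" by simp
    also have "\<dots> \<le> (card J + 2) * (card J + 2) ^ n"
      by (intro mult_left_mono power_mono) auto
    finally show ?thesis by (simp add: pat'_def card_k n)
  qed
qed

section \<open>Sparse vectors as a union of coordinate subspaces\<close>

lemma subset_image_lessThan_of_card_le:
  fixes A :: "'a set"
  assumes "finite A" "card A \<le> s"
  obtains t where "t \<in> {..<s} \<rightarrow>\<^sub>E UNIV" "A \<subseteq> t ` {..<s}"
proof -
  obtain h where h: "bij_betw h {0..<card A} A"
    using ex_bij_betw_nat_finite[OF assms(1)] by blast
  have "A \<subseteq> restrict h {..<s} ` {..<s}"
  proof
    fix x assume "x \<in> A"
    then obtain i where "i < card A" "x = h i"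
      using h by (force simp: bij_betw_def)
    then show "x \<in> restrict h {..<s} ` {..<s}" using assms(2) by force
  qed
  then show thesis by (intro that[of "restrict h {..<s}"]) auto
qed

definition coord_subspace :: "'d set \<Rightarrow> (real^'d) set" where
  "coord_subspace T = {v. \<forall>i. i \<notin> T \<longrightarrow> v $ i = 0}"

lemma subspace_coord_subspace: "subspace (coord_subspace T)"
  by (auto simp: coord_subspace_def subspace_def)

lemma aff_dim_coord_subspace: "aff_dim (coord_subspace (T :: 'd::finite set)) \<le> int (card T)"
proof -
  have "coord_subspace T \<subseteq> span ((\<lambda>i. axis i 1) ` T)"
  proof
    fix v :: "real^'d" assume v: "v \<in> coord_subspace T"
    have "v = (\<Sum>i\<in>UNIV. v $ i *\<^sub>R axis i 1)"
      by (simp add: vec_eq_iff axis_def if_distrib cong: if_cong)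
    also have "\<dots> = (\<Sum>i\<in>T. v $ i *\<^sub>R axis i 1)"
      by (rule sum.mono_neutral_right) (use v in \<open>auto simp: coord_subspace_def\<close>)
    also have "\<dots> \<in> span ((\<lambda>i. axis i 1) ` T)"
      by (intro span_sum span_scale span_base) auto
    finally show "v \<in> span ((\<lambda>i. axis i 1) ` T)" .
  qed
  then have "dim (coord_subspace T) \<le> card ((\<lambda>i. axis i (1::real)) ` T :: (real^'d) set)"
    by (rule dim_le_card) simp
  also have "\<dots> \<le> card T" by (rule card_image_le) simp
  finally show ?thesis by (simp add: aff_dim_subspace subspace_coord_subspace)
qed

text \<open>Every sparse vector lies in one of the subspaces indexed by \<open>Ts\<close>, each of
  dimension at most \<open>s\<close>; the affine bound applies to each, and the counts add
  up.\<close>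

lemma card_sparse_halfspace_patterns_le:
  fixes a :: "'j \<Rightarrow> real^'d::finite" and c :: "'j \<Rightarrow> real"
  assumes "finite J"
  shows "card ((\<lambda>v. {j \<in> J. a j \<bullet> v > c j}) ` sparse_vecs s) \<le> (CARD('d) * (card J + 1)) ^ s"
proof -
  define pat where "pat = (\<lambda>v. {j \<in> J. a j \<bullet> v > c j})"
  define Ts where "Ts = (\<Pi>\<^sub>E i\<in>{..<s}. UNIV :: 'd set)"
  have fin: "finite (pat ` A)" for A
    by (rule finite_subset[of _ "Pow J"]) (use assms in \<open>auto simp: pat_def\<close>)
  have finTs: "finite Ts" by (auto simp: Ts_def intro: finite_PiE)
  have "pat ` sparse_vecs s \<subseteq> (\<Union>t\<in>Ts. pat ` coord_subspace (t ` {..<s}))"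
  proof safe
    fix v :: "real^'d" assume "v \<in> sparse_vecs s"
    then obtain t where "t \<in> Ts" "{i. v $ i \<noteq> 0} \<subseteq> t ` {..<s}"
      using subset_image_lessThan_of_card_le[of "{i. v $ i \<noteq> 0}" s] by (auto simp: sparse_vecs_def Ts_def)
    then show "pat v \<in> (\<Union>t\<in>Ts. pat ` coord_subspace (t ` {..<s}))"
      by (force simp: coord_subspace_def)
  qed
  then have "card (pat ` sparse_vecs s) \<le> card (\<Union>t\<in>Ts. pat ` coord_subspace (t ` {..<s}))"
    by (intro card_mono) (auto simp: fin finTs)
  also have "\<dots> \<le> (\<Sum>t\<in>Ts. card (pat ` coord_subspace (t ` {..<s})))"
    by (rule card_UN_le[OF finTs])
  also have "\<dots> \<le> (\<Sum>t\<in>Ts. (card J + 1) ^ s)"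
  proof (rule sum_mono)
    fix t :: "nat \<Rightarrow> 'd"
    have "aff_dim (coord_subspace (t ` {..<s})) \<le> int s"
      using aff_dim_coord_subspace[of "t ` {..<s}"] card_image_le[of "{..<s}" t] by simp
    then have "(card J + 1) ^ nat (aff_dim (coord_subspace (t ` {..<s}))) \<le> (card J + 1) ^ s"
      by (intro power_increasing) auto
    with card_halfspace_patterns_le[OF assms subspace_imp_affine[OF subspace_coord_subspace],
        where a = a and c = c, of "t ` {..<s}"]
    show "card (pat ` coord_subspace (t ` {..<s})) \<le> (card J + 1) ^ s"
      by (simp add: pat_def)
  qed
  also have "\<dots> = (CARD('d) * (card J + 1)) ^ s"
    by (simp add: Ts_def card_PiE del: mult_Suc_right flip: power_mult_distrib)
  finally show ?thesis by (simp add: pat_def)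
qed

section \<open>The Gumbel-max identity\<close>

text \<open>The density is the derivative of the distribution function
  \<open>exp (- exp (- t))\<close>. Scale 1 is enough because the scale is absorbed into the weight
  vector.\<close>

definition gumbel :: "real measure" where
  "gumbel = density lborel (\<lambda>t. ennreal (exp (- t - exp (- t))))"

lemma space_gumbel [simp]: "space gumbel = UNIV"
  and sets_gumbel [simp, measurable_cong]: "sets gumbel = sets borel"
  by (simp_all add: gumbel_def)

text \<open>\<open>exp (- Z * exp (- t)) / Z\<close> is an antiderivative that vanishes at minus
  infinity. The extended real endpoint \<open>b\<close> covers both the distribution function
  (\<open>b\<close> finite, \<open>Z = 1\<close>) and the integral over the whole line used in the
  Gumbel-max identity.\<close>

lemma nn_integral_exp_minus_exp_einterval:
  fixes Z :: real and b :: ereal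
  assumes "Z > 0" "- \<infinity> < b"
    and lim: "(((\<lambda>t. exp (- Z * exp (- t)) / Z) \<circ> real_of_ereal) \<longlongrightarrow> B) (at_left b)"
  shows "(\<integral>\<^sup>+t. ennreal (exp (- t - Z * exp (- t))) * indicator (einterval (- \<infinity>) b) t \<partial>lborel) = ennreal B"
proof -
  let ?f = "\<lambda>t::real. exp (- t - Z * exp (- t))"
  let ?F = "\<lambda>t::real. exp (- Z * exp (- t)) / Z"
  have d: "DERIV ?F t :> ?f t" for t
  proof -
    have "?f t = exp (- Z * exp (- t)) * (Z * exp (- t)) / Z"
      using assms(1) by (simp flip: exp_add)
    then show ?thesis
      by (auto intro!: derivative_eq_intros)
  qed
  have lim0: "(?F \<longlongrightarrow> 0) at_bot"
    using assms(1) by real_asymp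
  have A: "((?F \<circ> real_of_ereal) \<longlongrightarrow> 0) (at_right (- \<infinity>))"
    using lim0 by (simp add: ereal_tendsto_simps)
  note FTC = interval_integral_FTC_nonneg[OF assms(2) d _ _ A lim]
  have int: "set_integrable lborel (einterval (- \<infinity>) b) ?f"
    by (rule FTC(1)) auto
  have val: "(LBINT t=- \<infinity>..b. ?f t) = B - 0"
    by (rule FTC(2)) auto
  have "(\<integral>\<^sup>+t. ennreal (?f t) * indicator (einterval (- \<infinity>) b) t \<partial>lborel)
      = (\<integral>\<^sup>+t. ennreal (indicator (einterval (- \<infinity>) b) t *\<^sub>R ?f t) \<partial>lborel)"
    by (intro nn_integral_cong) (auto split: split_indicator)
  also have "\<dots> = ennreal (\<integral>t. indicator (einterval (- \<infinity>) b) t *\<^sub>R ?f t \<partial>lborel)"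
    using int unfolding set_integrable_def by (intro nn_integral_eq_integral) auto
  also have "(\<integral>t. indicator (einterval (- \<infinity>) b) t *\<^sub>R ?f t \<partial>lborel) = B"
    using val assms(2) by (simp add: interval_lebesgue_integral_def set_lebesgue_integral_def)
  finally show ?thesis .
qed

lemma nn_integral_exp_minus_exp:
  fixes Z :: real
  assumes "Z > 0"
  shows "(\<integral>\<^sup>+t. ennreal (exp (- t - Z * exp (- t))) \<partial>lborel) = ennreal (1 / Z)"
proof -
  have "((\<lambda>t::real. exp (- Z * exp (- t)) / Z) \<longlongrightarrow> 1 / Z) at_top"
    using assms by (real_asymp simp: field_simps)
  then show ?thesis
    using nn_integral_exp_minus_exp_einterval[OF assms, of \<infinity> "1 / Z"] by (simp add: ereal_tendsto_simps)
qed

lemma emeasure_gumbel_atMost: "emeasure gumbel {..a} = ennreal (exp (- exp (- a)))"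
proof -
  have "((\<lambda>t::real. exp (- 1 * exp (- t)) / 1) \<longlongrightarrow> exp (- exp (- a))) (at_left a)"
    by (auto intro!: tendsto_eq_intros)
  then have *: "(\<integral>\<^sup>+t. ennreal (exp (- t - 1 * exp (- t))) * indicator (einterval (- \<infinity>) a) t \<partial>lborel)
      = ennreal (exp (- exp (- a)))"
    by (intro nn_integral_exp_minus_exp_einterval) (simp_all add: ereal_tendsto_simps)
  have "emeasure gumbel {..a} = (\<integral>\<^sup>+t. ennreal (exp (- t - exp (- t))) * indicator {..a} t \<partial>lborel)"
    by (simp add: gumbel_def emeasure_density)
  also have "\<dots> = (\<integral>\<^sup>+t. ennreal (exp (- t - 1 * exp (- t))) * indicator (einterval (- \<infinity>) a) t \<partial>lborel)"
    by (intro nn_integral_cong_AE eventually_mono[OF AE_lborel_singleton[of a]])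
       (auto split: split_indicator simp: einterval_iff)
  finally show ?thesis using * by simp
qed

lemma prob_space_gumbel: "prob_space gumbel"
  by standard (use nn_integral_exp_minus_exp[of 1] in \<open>simp add: gumbel_def emeasure_density\<close>)

text \<open>Condition on the value \<open>t\<close> of coordinate \<open>y\<close>. The other
  coordinates are independent, so \<open>y\<close> wins with probability
  \<open>exp (- (Z - 1) * exp (- t))\<close>, and integrating this against the density gives
  \<open>1 / Z\<close>. The candidates form a subset \<open>A\<close> of \<open>J\<close>, so that
  one Gumbel vector can serve several label sets.\<close>

lemma gumbel_max:
  fixes u :: "'y \<Rightarrow> real"
  assumes "finite J" "A \<subseteq> J" "y \<in> A"
  shows "measure (Pi\<^sub>M J (\<lambda>_. gumbel)) {\<gamma> \<in> space (Pi\<^sub>M J (\<lambda>_. gumbel)). \<forall>y'\<in>A. u y' + \<gamma> y' \<le> u y + \<gamma> y}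
    = exp (u y) / (\<Sum>y'\<in>A. exp (u y'))"
proof -
  interpret G: prob_space gumbel by (rule prob_space_gumbel)
  interpret product_prob_space "\<lambda>_. gumbel" J by standard
  define J' where "J' = J - {y}"
  have J: "J = insert y J'" and J': "finite J'" "y \<notin> J'" using assms by (auto simp: J'_def)
  have finA: "finite A" using assms finite_subset by blast
  define W where "W = {\<gamma> \<in> space (Pi\<^sub>M J (\<lambda>_. gumbel)). \<forall>y'\<in>A. u y' + \<gamma> y' \<le> u y + \<gamma> y}"
  have memJ: "y \<in> J" "\<And>y'. y' \<in> A \<Longrightarrow> y' \<in> J" using assms by auto
  have comp [measurable]: "(\<lambda>\<gamma>. \<gamma> j) \<in> borel_measurable (Pi\<^sub>M J (\<lambda>_. gumbel))" if "j \<in> J" for j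
    using measurable_component_singleton[OF that, of "\<lambda>_. gumbel"]
    by (simp cong: measurable_cong_sets)
  have W [measurable]: "W \<in> sets (Pi\<^sub>M J (\<lambda>_. gumbel))"
    unfolding W_def using finA memJ
    by (intro sets.sets_Collect_finite_All borel_measurable_le) (auto intro!: borel_measurable_add comp)
  \<comment> \<open>\<open>1 / Z\<close> is the softmax weight of \<open>y\<close>. The term for
    \<open>y\<close> itself equals 1, which leaves \<open>Z - 1\<close> for its rivals.\<close>
  define Z where "Z = (\<Sum>y'\<in>A. exp (u y' - u y))"
  have Z: "Z > 0" unfolding Z_def using finA assms by (intro sum_pos) auto
  have inner: "(\<integral>\<^sup>+x. indicator W (x(y := t)) \<partial>Pi\<^sub>M J' (\<lambda>_. gumbel))
      = ennreal (exp (- (Z - 1) * exp (- t)))" for t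
  proof -
    \<comment> \<open>For fixed \<open>t\<close> the event is a box: an upper bound for each rival
      in \<open>A\<close>, no constraint on labels outside \<open>A\<close>.\<close>
    define R where "R = (\<lambda>y'. if y' \<in> A then {..t + u y - u y'} else UNIV)"
    have "(\<integral>\<^sup>+x. indicator W (x(y := t)) \<partial>Pi\<^sub>M J' (\<lambda>_. gumbel))
        = (\<integral>\<^sup>+x. indicator (Pi\<^sub>E J' R) x \<partial>Pi\<^sub>M J' (\<lambda>_. gumbel))"
    proof (rule nn_integral_cong)
      fix x assume x: "x \<in> space (Pi\<^sub>M J' (\<lambda>_. gumbel))"
      have "x(y := t) \<in> W \<longleftrightarrow> (\<forall>y'\<in>A. y' \<noteq> y \<longrightarrow> u y' + x y' \<le> u y + t)"
        using x J' by (auto simp: W_def J space_PiM PiE_def extensional_def)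
      also have "\<dots> \<longleftrightarrow> x \<in> Pi\<^sub>E J' R"
        using x assms by (auto simp: R_def J'_def space_PiM PiE_iff algebra_simps)
      finally show "indicator W (x(y := t)) = (indicator (Pi\<^sub>E J' R) x :: ennreal)"
        by (auto split: split_indicator)
    qed
    also have "\<dots> = emeasure (Pi\<^sub>M J' (\<lambda>_. gumbel)) (Pi\<^sub>E J' R)"
      using J' by (intro nn_integral_indicator sets_PiM_I_finite) (auto simp: R_def)
    also have "\<dots> = (\<Prod>y'\<in>J'. emeasure gumbel (R y'))"
      using J' by (intro emeasure_PiM) (auto simp: R_def)
    also have "\<dots> = (\<Prod>y'\<in>A - {y}. ennreal (exp (- exp (- (t + u y - u y')))))"
      using J' assms G.emeasure_space_1
      by (intro prod.mono_neutral_cong_right) (auto simp: R_def J'_def emeasure_gumbel_atMost)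
    also have "\<dots> = ennreal (\<Prod>y'\<in>A - {y}. exp (- exp (- (t + u y - u y'))))"
      by (intro prod_ennreal) auto
    also have "(\<Prod>y'\<in>A - {y}. exp (- exp (- (t + u y - u y'))))
        = exp (\<Sum>y'\<in>A - {y}. - exp (- (t + u y - u y')))"
      using finA by (simp add: exp_sum)
    also have "(\<Sum>y'\<in>A - {y}. - exp (- (t + u y - u y'))) = - (\<Sum>y'\<in>A - {y}. exp (u y' - u y)) * exp (- t)"
      by (simp add: sum_negf sum_distrib_right flip: exp_add) (simp add: algebra_simps)
    also have "(\<Sum>y'\<in>A - {y}. exp (u y' - u y)) = Z - 1"
      using finA assms by (simp add: Z_def sum_diff1)
    finally show ?thesis .
  qed
  have "emeasure (Pi\<^sub>M J (\<lambda>_. gumbel)) W = (\<integral>\<^sup>+x. indicator W x \<partial>Pi\<^sub>M J (\<lambda>_. gumbel))"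
    by simp
  also have "\<dots> = (\<integral>\<^sup>+t. (\<integral>\<^sup>+x. indicator W (x(y := t)) \<partial>Pi\<^sub>M J' (\<lambda>_. gumbel)) \<partial>gumbel)"
    unfolding J by (rule product_nn_integral_insert_rev[OF J']) (use W J in simp)
  also have "\<dots> = (\<integral>\<^sup>+t. ennreal (exp (- (Z - 1) * exp (- t))) \<partial>gumbel)"
    by (simp only: inner)
  also have "\<dots> = (\<integral>\<^sup>+t. ennreal (exp (- t - exp (- t))) * ennreal (exp (- (Z - 1) * exp (- t))) \<partial>lborel)"
    unfolding gumbel_def by (rule nn_integral_density) auto
  also have "\<dots> = (\<integral>\<^sup>+t. ennreal (exp (- t - Z * exp (- t))) \<partial>lborel)"
    by (intro nn_integral_cong) (simp add: algebra_simps flip: ennreal_mult exp_add)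
  also have "\<dots> = ennreal (1 / Z)"
    by (rule nn_integral_exp_minus_exp[OF Z])
  finally have "measure (Pi\<^sub>M J (\<lambda>_. gumbel)) W = 1 / Z"
    using Z by (simp add: measure_def)
  also have "Z = (\<Sum>y'\<in>A. exp (u y')) / exp (u y)"
    by (simp add: Z_def exp_diff sum_divide_distrib)
  finally show ?thesis by (simp add: W_def)
qed

section \<open>Symmetrisation of the moment generating function\<close>

lemma exp_Max_image:
  fixes f :: "'v \<Rightarrow> real"
  assumes "finite F" "F \<noteq> {}"
  shows "exp (MAX v\<in>F. f v) = (MAX v\<in>F. exp (f v))"
  using mono_Max_commute[of "exp :: real \<Rightarrow> real" "f ` F"] assms
  by (simp add: mono_def image_image)

lemma abs_Max_le:
  fixes f :: "'v \<Rightarrow> real"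
  assumes "finite F" "F \<noteq> {}" "\<And>v. v \<in> F \<Longrightarrow> \<bar>f v\<bar> \<le> B"
  shows "\<bar>MAX v\<in>F. f v\<bar> \<le> B"
proof -
  have "(MAX v\<in>F. f v) \<in> f ` F" using assms by (intro Max_in) auto
  with assms(3) show ?thesis by auto
qed

lemma (in prob_space) integrable_exp_Max:
  fixes f :: "'v \<Rightarrow> 'a \<Rightarrow> real"
  assumes "finite F" "F \<noteq> {}"
    and meas: "\<And>v. v \<in> F \<Longrightarrow> f v \<in> borel_measurable M"
    and bound: "\<And>v x. v \<in> F \<Longrightarrow> \<bar>f v x\<bar> \<le> B"
  shows "integrable M (\<lambda>x. exp (MAX v\<in>F. f v x))"
proof (rule integrable_const_bound[where B = "exp B"])
  have "(MAX v\<in>F. f v x) \<le> B" for x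
    using abs_Max_le[of F "\<lambda>v. f v x" B] assms by fastforce
  then show "AE x in M. norm (exp (MAX v\<in>F. f v x)) \<le> exp B" by simp
  show "(\<lambda>x. exp (MAX v\<in>F. f v x)) \<in> borel_measurable M"
    using assms by (intro measurable_compose[OF borel_measurable_Max borel_measurable_exp]) auto
qed

text \<open>Jensen's inequality for \<open>exp\<close> is applied to each \<open>v\<close>
  separately, and each \<open>exp (f v x)\<close> lies below the exponential of the maximum. As
  \<open>exp\<close> is increasing, the maximum over \<open>F\<close> can be taken
  afterwards.\<close>

lemma (in prob_space) exp_Max_expectation_le:
  fixes f :: "'v \<Rightarrow> 'a \<Rightarrow> real"
  assumes F: "finite F" "F \<noteq> {}"
    and meas: "\<And>v. v \<in> F \<Longrightarrow> f v \<in> borel_measurable M"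
    and bound: "\<And>v x. v \<in> F \<Longrightarrow> \<bar>f v x\<bar> \<le> B"
  shows "exp (MAX v\<in>F. expectation (f v)) \<le> expectation (\<lambda>x. exp (MAX v\<in>F. f v x))"
proof -
  have "exp (expectation (f v)) \<le> expectation (\<lambda>x. exp (MAX v\<in>F. f v x))" if v: "v \<in> F" for v
  proof -
    have int: "integrable M (f v)"
      using meas bound v by (intro integrable_const_bound[where B = B]) auto
    have int_exp: "integrable M (\<lambda>x. exp (f v x))"
      using integrable_exp_Max[of "{v}" f B] meas bound v by simp
    have "exp (expectation (f v)) \<le> expectation (\<lambda>x. exp (f v x))"
      using jensens_inequality[OF int, where I = UNIV and q = exp] int_exp convex_on_exp[of 1] by simp
    also have "\<dots> \<le> expectation (\<lambda>x. exp (MAX v\<in>F. f v x))"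
      using v F by (intro integral_mono int_exp integrable_exp_Max[OF F meas bound]) auto
    finally show ?thesis .
  qed
  then show ?thesis
    using F by (simp add: exp_Max_image)
qed

section \<open>Moment generating function of a random sign sum\<close>

text \<open>This is \<open>cosh x \<le> exp (x\<^sup>2 / 2)\<close>, read off from the logarithmic
  inequality behind Hoeffding's lemma with weight \<open>1 / 2\<close> and step
  \<open>2 * y\<close>. That inequality concerns nonnegative arguments; evenness covers the
  rest.\<close>

lemma exp_add_exp_uminus_le:
  fixes x :: real
  shows "exp x + exp (- x) \<le> 2 * exp (x\<^sup>2 / 2)"
proof -
  have *: "exp y + exp (- y) \<le> 2 * exp (y\<^sup>2 / 2)" if "y \<ge> 0" for y :: real
  proof -
    have "1 + (1 / 2) * (exp (2 * y) - 1) > 0"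
      by (simp add: algebra_simps add_pos_pos)
    moreover have "ln (1 + (1 / 2) * (exp (2 * y) - 1)) \<le> y\<^sup>2 / 2 + y"
      using Hoeffdings_lemma_aux[of "2 * y" "1 / 2"] that by (simp add: power2_eq_square)
    ultimately have "1 + (1 / 2) * (exp (2 * y) - 1) \<le> exp (y\<^sup>2 / 2 + y)"
      by (metis exp_le_cancel_iff exp_ln)
    then have "(1 + exp (2 * y)) * exp (- y) \<le> 2 * exp (y\<^sup>2 / 2 + y) * exp (- y)"
      by (intro mult_right_mono) (auto simp: algebra_simps)
    then show ?thesis
      by (simp add: algebra_simps flip: exp_add)
  qed
  show ?thesis
    using *[of x] *[of "- x"] by (cases "x \<ge> 0") (auto simp: add.commute)
qed

text \<open>A subset \<open>A\<close> encodes the sign vector that is negative exactly on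
  \<open>A\<close>. The sum over all sign vectors factorises into one factor
  \<open>exp (- b i) + exp (b i)\<close> per index.\<close>

lemma sum_Pow_exp_signed_le:
  fixes b :: "'i \<Rightarrow> real" and c :: real
  assumes "finite I" and b: "\<And>i. i \<in> I \<Longrightarrow> \<bar>b i\<bar> \<le> c"
  shows "(\<Sum>A\<in>Pow I. exp (\<Sum>i\<in>I. if i \<in> A then - b i else b i)) \<le> 2 ^ card I * exp (card I * c\<^sup>2 / 2)"
proof -
  have "(\<Sum>A\<in>Pow I. exp (\<Sum>i\<in>I. if i \<in> A then - b i else b i))
      = (\<Sum>A\<in>Pow I. (\<Prod>i\<in>A. exp (- b i)) * (\<Prod>i\<in>I - A. exp (b i)))"
  proof (rule sum.cong[OF refl])
    fix A assume A: "A \<in> Pow I"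
    have "exp (\<Sum>i\<in>I. if i \<in> A then - b i else b i) = (\<Prod>i\<in>I. if i \<in> A then exp (- b i) else exp (b i))"
      by (simp add: exp_sum[OF assms(1)] if_distrib)
    also have "\<dots> = (\<Prod>i\<in>I \<inter> {i. i \<in> A}. exp (- b i)) * (\<Prod>i\<in>I \<inter> - {i. i \<in> A}. exp (b i))"
      by (rule prod.If_cases[OF assms(1)])
    also have "I \<inter> {i. i \<in> A} = A" using A by auto
    also have "I \<inter> - {i. i \<in> A} = I - A" by auto
    finally show "exp (\<Sum>i\<in>I. if i \<in> A then - b i else b i)
        = (\<Prod>i\<in>A. exp (- b i)) * (\<Prod>i\<in>I - A. exp (b i))" .
  qed
  also have "\<dots> = (\<Prod>i\<in>I. exp (- b i) + exp (b i))"
    by (rule prod_add[OF assms(1), symmetric])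
  also have "\<dots> \<le> (\<Prod>i\<in>I. 2 * exp (c\<^sup>2 / 2))"
  proof (rule prod_mono)
    fix i assume i: "i \<in> I"
    have "(b i)\<^sup>2 \<le> c\<^sup>2" using b[OF i] by (metis abs_ge_zero power2_abs power_mono)
    then have "exp ((b i)\<^sup>2 / 2) \<le> exp (c\<^sup>2 / 2)" by simp
    then have "exp (- b i) + exp (b i) \<le> 2 * exp (c\<^sup>2 / 2)"
      using exp_add_exp_uminus_le[of "b i"] by linarith
    then show "0 \<le> exp (- b i) + exp (b i) \<and> exp (- b i) + exp (b i) \<le> 2 * exp (c\<^sup>2 / 2)"
      by (simp add: add_nonneg_nonneg)
  qed
  also have "\<dots> = 2 ^ card I * exp (card I * c\<^sup>2 / 2)"
    by (simp add: power_mult_distrib flip: exp_of_nat_mult)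
  finally show ?thesis .
qed

section \<open>Exchanging sample and ghost sample\<close>

text \<open>On indices below \<open>2 * m\<close> this is the involution that transposes
  \<open>i\<close> and \<open>m + i\<close> for each \<open>i < m\<close> in \<open>A\<close>;
  applied to the coordinates of a double sample, it flips the sign of the corresponding
  differences.\<close>

definition swap_ghost :: "nat \<Rightarrow> nat set \<Rightarrow> nat \<Rightarrow> nat" where
  "swap_ghost m A i = (if i < m then (if i \<in> A then m + i else i) else if i - m \<in> A then i - m else i)"

lemma swap_ghost_swap_ghost: "i < 2 * m \<Longrightarrow> swap_ghost m A (swap_ghost m A i) = i"
  by (cases "i < m") (auto simp: swap_ghost_def)

lemma swap_ghost_less: "i < 2 * m \<Longrightarrow> swap_ghost m A i < 2 * m"
  by (auto simp: swap_ghost_def)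

text \<open>The ghost sample occupies the indices \<open>m..<2 * m\<close>; \<open>A\<close> is the set of coordinates
  on which sample and ghost sample are exchanged.\<close>
lemma exp_Max_deviation_le_symmetrized:
  fixes f :: "'v \<Rightarrow> 'z \<Rightarrow> real" and D :: "'z measure"
  assumes D: "prob_space D" and F: "finite F" "F \<noteq> {}"
    and meas: "\<And>v. v \<in> F \<Longrightarrow> f v \<in> borel_measurable D"
    and bound: "\<And>v x. v \<in> F \<Longrightarrow> \<bar>f v x\<bar> \<le> B"
    and sym: "\<And>z. (\<Sum>A\<in>Pow {..<m}. exp (MAX v\<in>F. \<Sum>i<m. if i \<in> A
        then - (f v (z (m + i)) - f v (z i)) else f v (z (m + i)) - f v (z i))) \<le> 2 ^ m * C"
  shows "(\<integral>S. exp (MAX v\<in>F. \<Sum>i<m. (\<integral>x. f v x \<partial>D) - f v (S i)) \<partial>Pi\<^sub>M {..<m} (\<lambda>_. D)) \<le> C"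
proof -
  interpret D: prob_space D by fact
  interpret product_prob_space "\<lambda>_. D" UNIV by standard
  define P where "P I = Pi\<^sub>M I (\<lambda>_. D)" for I :: "nat set"
  have prob_P: "prob_space (P I)" for I unfolding P_def by (intro prob_space_PiM D)
  have comp: "(\<lambda>S. f v (S i)) \<in> borel_measurable (P I)" if "v \<in> F" "i \<in> I" for v i I
    unfolding P_def using measurable_compose[OF measurable_component_singleton[OF that(2)] meas[OF that(1)]] .
  have B0: "B \<ge> 0" using F bound by (metis abs_ge_zero all_not_in_conv order_trans)
  have sum_bound: "\<bar>\<Sum>i<m. h i\<bar> \<le> real m * (2 * B)" if "\<And>i. i < m \<Longrightarrow> \<bar>h i\<bar> \<le> 2 * B" for h :: "nat \<Rightarrow> real"
    using sum_norm_bound[of "{..<m}" h "2 * B"] that by simp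
  have diff_bound: "\<bar>f v x - f v y\<bar> \<le> 2 * B" if "v \<in> F" for v x y
    using bound[OF that, of x] bound[OF that, of y] by linarith
  define I J where "I = {..<m}" and "J = {m..<2 * m}"
  \<comment> \<open>\<open>\<Phi> {}\<close> is the exponential of the largest sum of
    ghost-minus-sample differences over \<open>F\<close>; in \<open>\<Phi> A\<close> the signs on
    \<open>A\<close> are reversed.\<close>
  define \<Phi> where "\<Phi> A z = exp (MAX v\<in>F. \<Sum>i<m. if i \<in> A
        then - (f v (z (m + i)) - f v (z i)) else f v (z (m + i)) - f v (z i))" for A z
  have memJ: "m + i \<in> J" if "i < m" for i using that by (simp add: J_def)
  have IJ: "I \<inter> J = {}" "finite I" "finite J" by (auto simp: I_def J_def)
  interpret PJ: prob_space "P J" by (rule prob_P)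
  interpret PI: prob_space "P I" by (rule prob_P)
  interpret PIJ: prob_space "P (I \<union> J)" by (rule prob_P)
  have int_\<Phi>: "integrable (P (I \<union> J)) (\<Phi> A)" for A
    unfolding \<Phi>_def
  proof (rule PIJ.integrable_exp_Max[OF F, where B = "real m * (2 * B)"])
    fix v assume v: "v \<in> F"
    show "(\<lambda>z. \<Sum>i<m. if i \<in> A then - (f v (z (m + i)) - f v (z i)) else f v (z (m + i)) - f v (z i))
        \<in> borel_measurable (P (I \<union> J))"
      using v by (intro borel_measurable_sum measurable_If borel_measurable_diff borel_measurable_uminus comp)
        (auto simp: I_def J_def)
    show "\<bar>\<Sum>i<m. if i \<in> A then - (f v (z (m + i)) - f v (z i)) else f v (z (m + i)) - f v (z i)\<bar>
        \<le> real m * (2 * B)" for z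
      using diff_bound[OF v] by (intro sum_bound) (simp add: abs_minus_commute)
  qed
  have exp_f: "(\<integral>S. f v (S i) \<partial>P J) = (\<integral>x. f v x \<partial>D)" if "v \<in> F" "i \<in> J" for v i
  proof -
    have "(\<integral>x. f v x \<partial>D) = (\<integral>x. f v x \<partial>distr (P J) D (\<lambda>S. S i))"
      unfolding P_def using distr_PiM_component[of J "\<lambda>_. D" i] D that by simp
    also have "\<dots> = (\<integral>S. f v (S i) \<partial>P J)"
      unfolding P_def using that by (intro integral_distr meas measurable_component_singleton)
    finally show ?thesis by simp
  qed
  \<comment> \<open>The mean of \<open>f v\<close> is the expectation over a ghost draw, and
    Jensen's inequality moves that expectation outside maximum and exponential. \<open>merge\<close>
    joins both samples into one point of the product space.\<close>
  have ghost: "exp (MAX v\<in>F. \<Sum>i<m. (\<integral>x. f v x \<partial>D) - f v (S i)) \<le> (\<integral>S'. \<Phi> {} (merge I J (S, S')) \<partial>P J)" for S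
  proof -
    have "(\<Sum>i<m. (\<integral>x. f v x \<partial>D) - f v (S i)) = (\<integral>S'. (\<Sum>i<m. f v (S' (m + i)) - f v (S i)) \<partial>P J)"
      if v: "v \<in> F" for v
    proof -
      have int: "integrable (P J) (\<lambda>S'. f v (S' (m + i)))" if "i < m" for i
        using that v bound by (intro PJ.integrable_const_bound[where B = B] comp) (auto simp: J_def)
      have "(\<integral>S'. (\<Sum>i<m. f v (S' (m + i)) - f v (S i)) \<partial>P J) = (\<Sum>i<m. \<integral>S'. f v (S' (m + i)) - f v (S i) \<partial>P J)"
        using int by (intro Bochner_Integration.integral_sum) auto
      also have "\<dots> = (\<Sum>i<m. (\<integral>x. f v x \<partial>D) - f v (S i))"
        using int v by (intro sum.cong) (simp_all add: exp_f memJ PJ.prob_space)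
      finally show ?thesis by simp
    qed
    then have "exp (MAX v\<in>F. \<Sum>i<m. (\<integral>x. f v x \<partial>D) - f v (S i))
        = exp (MAX v\<in>F. (\<integral>S'. (\<Sum>i<m. f v (S' (m + i)) - f v (S i)) \<partial>P J))"
      by (simp cong: image_cong)
    also have "\<dots> \<le> (\<integral>S'. exp (MAX v\<in>F. \<Sum>i<m. f v (S' (m + i)) - f v (S i)) \<partial>P J)"
    proof (rule PJ.exp_Max_expectation_le[OF F, where B = "real m * (2 * B)"])
      fix v assume v: "v \<in> F"
      show "(\<lambda>S'. \<Sum>i<m. f v (S' (m + i)) - f v (S i)) \<in> borel_measurable (P J)"
        using v by (intro borel_measurable_sum borel_measurable_diff comp borel_measurable_const) (auto simp: J_def)
      show "\<bar>\<Sum>i<m. f v (S' (m + i)) - f v (S i)\<bar> \<le> real m * (2 * B)" for S'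
        using diff_bound[OF v] by (intro sum_bound) auto
    qed
    also have "\<dots> = (\<integral>S'. \<Phi> {} (merge I J (S, S')) \<partial>P J)"
      by (simp add: \<Phi>_def merge_def I_def J_def)
    finally show ?thesis .
  qed
  have "(\<integral>S. exp (MAX v\<in>F. \<Sum>i<m. (\<integral>x. f v x \<partial>D) - f v (S i)) \<partial>P I)
      \<le> (\<integral>S. (\<integral>S'. \<Phi> {} (merge I J (S, S')) \<partial>P J) \<partial>P I)"
  proof (rule integral_mono[OF _ _ ghost])
    show "integrable (P I) (\<lambda>S. exp (MAX v\<in>F. \<Sum>i<m. (\<integral>x. f v x \<partial>D) - f v (S i)))"
    proof (rule PI.integrable_exp_Max[OF F, where B = "real m * (2 * B)"])
      fix v assume v: "v \<in> F"
      show "(\<lambda>S. \<Sum>i<m. (\<integral>x. f v x \<partial>D) - f v (S i)) \<in> borel_measurable (P I)"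
        using v by (intro borel_measurable_sum borel_measurable_diff comp borel_measurable_const) (auto simp: I_def)
      have "\<bar>\<integral>x. f v x \<partial>D\<bar> \<le> B"
      proof -
        have "norm (\<integral>x. f v x \<partial>D) \<le> (\<integral>x. norm (f v x) \<partial>D)" by (rule integral_norm_bound)
        also have "\<dots> \<le> (\<integral>x. B \<partial>D)"
          using v bound meas B0 by (intro integral_mono D.integrable_const_bound[where B = B]) auto
        finally show ?thesis by (simp add: D.prob_space)
      qed
      then have "\<bar>(\<integral>x. f v x \<partial>D) - f v (S i)\<bar> \<le> 2 * B" for S i
        using bound[OF v, of "S i"] by linarith
      then show "\<bar>\<Sum>i<m. (\<integral>x. f v x \<partial>D) - f v (S i)\<bar> \<le> real m * (2 * B)" for S
        by (intro sum_bound)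
    qed
    interpret pair_sigma_finite "P I" "P J" by standard
    have "integrable (Pi\<^sub>M I (\<lambda>_. D) \<Otimes>\<^sub>M Pi\<^sub>M J (\<lambda>_. D)) (\<lambda>x. \<Phi> {} (merge I J x))"
    proof -
      have "integrable (distr (Pi\<^sub>M I (\<lambda>_. D) \<Otimes>\<^sub>M Pi\<^sub>M J (\<lambda>_. D)) (Pi\<^sub>M (I \<union> J) (\<lambda>_. D)) (merge I J)) (\<Phi> {})"
        using int_\<Phi>[of "{}"] distr_merge[OF IJ] by (simp add: P_def)
      then show ?thesis by (rule integrable_distr[OF measurable_merge])
    qed
    then show "integrable (P I) (\<lambda>S. \<integral>S'. \<Phi> {} (merge I J (S, S')) \<partial>P J)"
      using integrable_fst[of "\<lambda>S S'. \<Phi> {} (merge I J (S, S'))"] by (simp add: P_def case_prod_beta')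
  qed
  also have "\<dots> = (\<integral>z. \<Phi> {} z \<partial>P (I \<union> J))"
    unfolding P_def by (rule product_integral_fold[OF IJ, symmetric]) (use int_\<Phi>[of "{}"] in \<open>simp add: P_def\<close>)
  finally have ghost': "(\<integral>S. exp (MAX v\<in>F. \<Sum>i<m. (\<integral>x. f v x \<partial>D) - f v (S i)) \<partial>P I)
      \<le> (\<integral>z. \<Phi> {} z \<partial>P (I \<union> J))" .
  \<comment> \<open>Permuting i.i.d. coordinates preserves the product measure, while
    \<open>swap_ghost m A\<close> turns \<open>\<Phi> {}\<close> into \<open>\<Phi> A\<close>; hence
    all sign choices have the same expectation.\<close>
  have swap: "(\<integral>z. \<Phi> {} z \<partial>P (I \<union> J)) = (\<integral>z. \<Phi> A z \<partial>P (I \<union> J))" for A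
  proof -
    define t where "t = swap_ghost m A"
    have IJ_eq: "I \<union> J = {..<2 * m}" by (auto simp: I_def J_def)
    have t: "inj_on t (I \<union> J)" "t \<in> I \<union> J \<rightarrow> I \<union> J"
      unfolding IJ_eq t_def
      by (auto intro: inj_on_inverseI[where g = "swap_ghost m A"] simp: swap_ghost_swap_ghost swap_ghost_less)
    let ?T = "\<lambda>z. \<lambda>n\<in>I \<union> J. z (t n)"
    have T: "?T \<in> P (I \<union> J) \<rightarrow>\<^sub>M P (I \<union> J)"
      unfolding P_def using t(2) by (intro measurable_restrict measurable_component_singleton) auto
    have "(\<integral>z. \<Phi> {} z \<partial>P (I \<union> J)) = (\<integral>z. \<Phi> {} z \<partial>distr (P (I \<union> J)) (P (I \<union> J)) ?T)"
      unfolding P_def using distr_PiM_reindex[OF _ t, of "\<lambda>_. D"] D by simp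
    also have "\<dots> = (\<integral>z. \<Phi> {} (?T z) \<partial>P (I \<union> J))"
      using int_\<Phi>[of "{}"] by (intro integral_distr T) auto
    also have "\<dots> = (\<integral>z. \<Phi> A z \<partial>P (I \<union> J))"
    proof (rule Bochner_Integration.integral_cong[OF refl])
      fix z
      have "(\<Sum>i<m. f v (?T z (m + i)) - f v (?T z i))
        = (\<Sum>i<m. if i \<in> A then - (f v (z (m + i)) - f v (z i)) else f v (z (m + i)) - f v (z i))" for v
        by (intro sum.cong) (auto simp: t_def swap_ghost_def IJ_eq)
      then show "\<Phi> {} (?T z) = \<Phi> A z" by (simp add: \<Phi>_def)
    qed
    finally show ?thesis .
  qed
  \<comment> \<open>The average over signs is taken under the integral, where \<open>sym\<close>
    bounds it for each fixed double sample.\<close>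
  have "2 ^ m * (\<integral>z. \<Phi> {} z \<partial>P (I \<union> J)) = (\<Sum>A\<in>Pow {..<m}. (\<integral>z. \<Phi> {} z \<partial>P (I \<union> J)))"
    by (simp add: card_Pow)
  also have "\<dots> = (\<Sum>A\<in>Pow {..<m}. (\<integral>z. \<Phi> A z \<partial>P (I \<union> J)))"
    by (intro sum.cong refl swap)
  also have "\<dots> = (\<integral>z. (\<Sum>A\<in>Pow {..<m}. \<Phi> A z) \<partial>P (I \<union> J))"
    using int_\<Phi> by (intro Bochner_Integration.integral_sum[symmetric])
  also have "\<dots> \<le> (\<integral>z. 2 ^ m * C \<partial>P (I \<union> J))"
    using int_\<Phi> sym[folded \<Phi>_def] by (intro integral_mono Bochner_Integration.integrable_sum) auto
  also have "\<dots> = 2 ^ m * C" by (simp add: PIJ.prob_space)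
  finally have "(\<integral>z. \<Phi> {} z \<partial>P (I \<union> J)) \<le> C" by simp
  with ghost' show ?thesis by (simp add: P_def I_def)
qed

text \<open>Each loss \<open>prob (G v j)\<close> is an average of 0/1 losses over the points
  \<open>w\<close>. Jensen's inequality moves this average outside, and for fixed \<open>w\<close>
  the maximum runs over at most \<open>K\<close> loss vectors. Bounding it by the sum over these
  vectors costs a factor \<open>K\<close>, whatever the size of \<open>F\<close>.\<close>

lemma (in prob_space) sum_Pow_exp_Max_mixture_le:
  fixes G :: "'v \<Rightarrow> nat \<Rightarrow> 'a set" and c :: real
  assumes F: "finite F" "F \<noteq> {}"
    and G: "\<And>v j. v \<in> F \<Longrightarrow> j < 2 * m \<Longrightarrow> G v j \<in> events"
    and K: "\<And>w. w \<in> space M \<Longrightarrow> card ((\<lambda>v. {j. j < 2 * m \<and> w \<in> G v j}) ` F) \<le> K"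
    and c: "c \<ge> 0"
  shows "(\<Sum>A\<in>Pow {..<m}. exp (MAX v\<in>F. \<Sum>i<m. if i \<in> A
        then - (c * prob (G v (m + i)) - c * prob (G v i)) else c * prob (G v (m + i)) - c * prob (G v i)))
      \<le> 2 ^ m * (real K * exp (m * c\<^sup>2 / 2))"
proof -
  \<comment> \<open>The signed sum as a function of the set \<open>p\<close> of indices with loss 1
    alone: vectors \<open>v\<close> with the same pattern are not distinguished.\<close>
  define q where "q A p = (\<Sum>i<m. if i \<in> A
      then - (c * of_bool (m + i \<in> p) - c * of_bool (i \<in> p)) else c * of_bool (m + i \<in> p) - c * of_bool (i \<in> p))"
    for A p :: "nat set"
  define pat where "pat w v = {j. j < 2 * m \<and> w \<in> G v j}" for w v
  define H where "H A v w = (\<Sum>i<m. if i \<in> A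
      then - (c * indicator (G v (m + i)) w - c * indicator (G v i) w)
      else c * indicator (G v (m + i)) w - c * (indicator (G v i) w :: real))" for A v w
  have H_eq: "H A v w = q A (pat w v)" for A v w
    unfolding H_def q_def pat_def by (intro sum.cong) (auto simp: indicator_def)
  have H_meas: "H A v \<in> borel_measurable M" if "v \<in> F" for A v
    unfolding H_def using that G
    by (intro borel_measurable_sum measurable_If borel_measurable_diff borel_measurable_uminus
        borel_measurable_times borel_measurable_const borel_measurable_indicator) auto
  have H_bound: "\<bar>H A v w\<bar> \<le> real m * c" for A v w
  proof -
    have "norm (H A v w) \<le> of_nat (card {..<m}) * c"
      unfolding H_def by (rule sum_norm_bound) (use c in \<open>auto split: split_indicator\<close>)
    then show ?thesis by simp
  qed
  have H_int: "expectation (H A v) = (\<Sum>i<m. if i \<in> A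
      then - (c * prob (G v (m + i)) - c * prob (G v i)) else c * prob (G v (m + i)) - c * prob (G v i))"
    if v: "v \<in> F" for A v
  proof -
    have int: "integrable M (indicator (G v j) :: _ \<Rightarrow> real)" if "j < 2 * m" for j
      using G[OF v that] by (intro integrable_real_indicator) (auto simp: emeasure_eq_measure)
    have val: "expectation (indicator (G v j)) = prob (G v j)" if "j < 2 * m" for j
      using G[OF v that] by (simp add: sets.Int_space_eq2)
    let ?d = "\<lambda>i w. c * indicator (G v (m + i)) w - c * (indicator (G v i) w :: real)"
    have int_d: "integrable M (?d i)" if "i < m" for i
      using that by (intro Bochner_Integration.integrable_diff integrable_mult_right int) auto
    have val_d: "expectation (?d i) = c * prob (G v (m + i)) - c * prob (G v i)" if "i < m" for i
      using that int[of "m + i"] int[of i] val[of "m + i"] val[of i]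
      by (subst Bochner_Integration.integral_diff) auto
    have "expectation (H A v) = (\<Sum>i<m. expectation (\<lambda>w. if i \<in> A then - ?d i w else ?d i w))"
      unfolding H_def
    proof (rule Bochner_Integration.integral_sum)
      fix i assume "i \<in> {..<m}"
      then show "integrable M (\<lambda>w. if i \<in> A then - ?d i w else ?d i w)"
        using int_d[of i] by (cases "i \<in> A") (simp_all del: minus_diff_eq)
    qed
    also have "\<dots> = (\<Sum>i<m. if i \<in> A
      then - (c * prob (G v (m + i)) - c * prob (G v i)) else c * prob (G v (m + i)) - c * prob (G v i))"
      using val_d by (intro sum.cong) (simp_all del: minus_diff_eq)
    finally show ?thesis .
  qed
  have point: "(\<Sum>A\<in>Pow {..<m}. exp (MAX v\<in>F. H A v w)) \<le> 2 ^ m * (real K * exp (m * c\<^sup>2 / 2))"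
    if w: "w \<in> space M" for w
  proof -
    have "(\<Sum>A\<in>Pow {..<m}. exp (MAX v\<in>F. H A v w)) \<le> (\<Sum>A\<in>Pow {..<m}. \<Sum>p\<in>pat w ` F. exp (q A p))"
    proof (rule sum_mono)
      fix A assume "A \<in> Pow {..<m}"
      have "(MAX v\<in>F. H A v w) \<in> (\<lambda>v. H A v w) ` F" using F by (intro Max_in) auto
      then obtain v where v: "v \<in> F" "(MAX v\<in>F. H A v w) = q A (pat w v)"
        by (auto simp: H_eq)
      show "exp (MAX v\<in>F. H A v w) \<le> (\<Sum>p\<in>pat w ` F. exp (q A p))"
        unfolding v(2) using v(1) F by (intro member_le_sum) auto
    qed
    also have "\<dots> = (\<Sum>p\<in>pat w ` F. \<Sum>A\<in>Pow {..<m}. exp (q A p))"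
      by (rule sum.swap)
    also have "\<dots> \<le> (\<Sum>p\<in>pat w ` F. 2 ^ m * exp (m * c\<^sup>2 / 2))"
    proof (rule sum_mono)
      fix p :: "nat set"
      show "(\<Sum>A\<in>Pow {..<m}. exp (q A p)) \<le> 2 ^ m * exp (m * c\<^sup>2 / 2)"
        unfolding q_def
        using sum_Pow_exp_signed_le[where I = "{..<m}" and c = c
            and b = "\<lambda>i. c * of_bool (m + i \<in> p) - c * of_bool (i \<in> p)"] c
        by (simp add: abs_if of_bool_def)
    qed
    also have "\<dots> = real (card (pat w ` F)) * (2 ^ m * exp (m * c\<^sup>2 / 2))" by simp
    also have "\<dots> \<le> real K * (2 ^ m * exp (m * c\<^sup>2 / 2))"
      using K[OF w] by (intro mult_right_mono) (auto simp: pat_def)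
    finally show ?thesis by (simp add: mult_ac)
  qed
  have int: "integrable M (\<lambda>w. exp (MAX v\<in>F. H A v w))" for A
    by (rule integrable_exp_Max[OF F H_meas H_bound])
  have "(\<Sum>A\<in>Pow {..<m}. exp (MAX v\<in>F. \<Sum>i<m. if i \<in> A
        then - (c * prob (G v (m + i)) - c * prob (G v i)) else c * prob (G v (m + i)) - c * prob (G v i)))
      = (\<Sum>A\<in>Pow {..<m}. exp (MAX v\<in>F. expectation (H A v)))"
    by (simp add: H_int cong: image_cong)
  also have "\<dots> \<le> (\<Sum>A\<in>Pow {..<m}. expectation (\<lambda>w. exp (MAX v\<in>F. H A v w)))"
    by (intro sum_mono exp_Max_expectation_le[OF F H_meas H_bound])
  also have "\<dots> = expectation (\<lambda>w. \<Sum>A\<in>Pow {..<m}. exp (MAX v\<in>F. H A v w))"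
    using int by (intro Bochner_Integration.integral_sum[symmetric])
  also have "\<dots> \<le> expectation (\<lambda>w. 2 ^ m * (real K * exp (m * c\<^sup>2 / 2)))"
    using int point by (intro integral_mono) auto
  finally show ?thesis by (simp add: prob_space)
qed

section \<open>Uniform deviation of the decoder loss\<close>

lemma pred_prob_bounds:
  assumes "finite (Y x)"
  shows "0 \<le> pred_prob Y \<phi> b w x y" "pred_prob Y \<phi> b w x y \<le> 1"
proof -
  have "0 \<le> pred_prob Y \<phi> b w x y \<and> pred_prob Y \<phi> b w x y \<le> 1"
  proof (cases "y \<in> Y x")
    case True
    then have "exp ((\<phi> x y \<bullet> w) / b) \<le> (\<Sum>y'\<in>Y x. exp ((\<phi> x y' \<bullet> w) / b))"
      using assms by (intro member_le_sum) auto
    moreover have "0 \<le> (\<Sum>y'\<in>Y x. exp ((\<phi> x y' \<bullet> w) / b))" by (intro sum_nonneg) auto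
    ultimately show ?thesis using True by (simp add: pred_prob_def divide_le_eq)
  qed (simp add: pred_prob_def)
  then show "0 \<le> pred_prob Y \<phi> b w x y" "pred_prob Y \<phi> b w x y \<le> 1" by auto
qed

lemma err_bounds:
  assumes "\<And>x. finite (Y x)"
  shows "0 \<le> err Y \<phi> b w p" "err Y \<phi> b w p \<le> 1" "\<bar>err Y \<phi> b w p\<bar> \<le> 1"
  using pred_prob_bounds[of Y "fst p" \<phi> b w "snd p"] assms by (auto simp: err_def)

lemma err_rescale: "err Y \<phi> b w = err Y \<phi> 1 (w /\<^sub>R b)"
  by (rule ext) (simp add: err_def pred_prob_def field_simps)

text \<open>For a fixed double sample, a single Gumbel vector over the union \<open>J\<close> of the
  label sets is shared by all examples; by linearity of expectation each example enters through its
  own marginal. As the vector does not depend on \<open>v\<close>, it suffices to count the 0/1 loss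
  vectors for each of its values.\<close>

lemma sum_Pow_exp_Max_err_le:
  fixes Y :: "'x \<Rightarrow> 'y set" and \<phi> :: "'x \<Rightarrow> 'y \<Rightarrow> real^'d::finite" and z :: "nat \<Rightarrow> 'x \<times> 'y" and c :: real
  assumes Y_fin: "\<And>x. finite (Y x)" and Y_card: "\<And>x. card (Y x) \<le> r"
    and F: "finite F" "F \<noteq> {}" "F \<subseteq> sparse_vecs s" and c: "c \<ge> 0"
  defines "e \<equiv> \<lambda>v. err Y \<phi> 1 v"
  shows "(\<Sum>A\<in>Pow {..<m}. exp (MAX v\<in>F. \<Sum>i<m. if i \<in> A
        then - (c * e v (z (m + i)) - c * e v (z i)) else c * e v (z (m + i)) - c * e v (z i)))
      \<le> 2 ^ m * (real ((CARD('d) * (2 * m * r + 1)) ^ s) * exp (m * c\<^sup>2 / 2))"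
proof -
  define X where "X j = fst (z j)" for j
  define T where "T j = snd (z j)" for j
  define J where "J = (\<Union>j<2*m. Y (X j))"
  define M where "M = Pi\<^sub>M J (\<lambda>_. gumbel)"
  have J: "finite J" "\<And>j. j < 2 * m \<Longrightarrow> Y (X j) \<subseteq> J" using Y_fin by (auto simp: J_def)
  interpret M: prob_space M unfolding M_def by (intro prob_space_PiM prob_space_gumbel)
  define u where "u v j y = \<phi> (X j) y \<bullet> v" for v j y
  define W where "W v j = {\<gamma> \<in> space M. T j \<in> Y (X j) \<and> (\<forall>y'\<in>Y (X j). u v j y' + \<gamma> y' \<le> u v j (T j) + \<gamma> (T j))}" for v j
  have comp: "(\<lambda>\<gamma>. \<gamma> y) \<in> borel_measurable M" if "y \<in> J" for y
    using measurable_component_singleton[OF that, of "\<lambda>_. gumbel"]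
    by (simp add: M_def cong: measurable_cong_sets)
  have W: "W v j \<in> sets M" if "j < 2 * m" for v j
  proof (cases "T j \<in> Y (X j)")
    case True
    with J(2)[OF that] Y_fin show ?thesis
      unfolding W_def
      by (auto intro!: sets.sets_Collect_finite_All borel_measurable_le borel_measurable_add comp)
  qed (simp add: W_def)
  have e_W: "e v (z j) = M.prob (space M - W v j)" if "j < 2 * m" for v j
  proof -
    have "M.prob (W v j) = pred_prob Y \<phi> 1 v (X j) (T j)"
    proof (cases "T j \<in> Y (X j)")
      case True
      then show ?thesis
        using gumbel_max[OF J(1) J(2)[OF that] True, of "u v j"]
        by (simp add: W_def M_def pred_prob_def u_def)
    qed (simp add: W_def pred_prob_def)
    then show ?thesis
      using M.prob_compl[OF W[OF that]] by (simp add: e_def err_def X_def T_def)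
  qed
  \<comment> \<open>One affine inequality per example and candidate label, hence at most
    \<open>2 * m * r\<close> of them.\<close>
  define Q where "Q = (SIGMA j:{..<2*m}. Y (X j))"
  have finQ: "finite Q" using Y_fin by (auto simp: Q_def)
  have cardQ: "card Q \<le> 2 * m * r"
    unfolding Q_def using Y_fin sum_bounded_above[of "{..<2*m}" "\<lambda>j. card (Y (X j))" r] Y_card
    by (subst card_SigmaI) auto
  have count: "card ((\<lambda>v. {j. j < 2 * m \<and> \<gamma> \<in> space M - W v j}) ` F) \<le> (CARD('d) * (2 * m * r + 1)) ^ s"
    if \<gamma>: "\<gamma> \<in> space M" for \<gamma>
  proof -
    define a where "a k = \<phi> (X (fst k)) (snd k) - \<phi> (X (fst k)) (T (fst k))" for k
    define b where "b k = \<gamma> (T (fst k)) - \<gamma> (snd k)" for k :: "nat \<times> 'y"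
    define pat where "pat v = {k \<in> Q. a k \<bullet> v > b k}" for v
    define proj where "proj p = {j. j < 2 * m \<and> (T j \<in> Y (X j) \<longrightarrow> (\<exists>y'. (j, y') \<in> p))}" for p :: "(nat \<times> 'y) set"
    have "{j. j < 2 * m \<and> \<gamma> \<in> space M - W v j} = proj (pat v)" for v
      using \<gamma> by (auto simp: W_def proj_def pat_def Q_def a_def b_def u_def inner_diff_left not_le algebra_simps)
    then have "(\<lambda>v. {j. j < 2 * m \<and> \<gamma> \<in> space M - W v j}) ` F = proj ` pat ` F"
      by (simp add: image_image)
    moreover have fin: "finite (pat ` S)" for S
      by (rule finite_subset[of _ "Pow Q"]) (use finQ in \<open>auto simp: pat_def\<close>)
    ultimately have "card ((\<lambda>v. {j. j < 2 * m \<and> \<gamma> \<in> space M - W v j}) ` F) \<le> card (pat ` F)"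
      by (simp add: card_image_le)
    also have "\<dots> \<le> card (pat ` sparse_vecs s)"
      using F by (intro card_mono fin image_mono)
    also have "\<dots> \<le> (CARD('d) * (card Q + 1)) ^ s"
      unfolding pat_def by (rule card_sparse_halfspace_patterns_le[OF finQ])
    also have "\<dots> \<le> (CARD('d) * (2 * m * r + 1)) ^ s"
      using cardQ by (intro power_mono mult_left_mono) auto
    finally show ?thesis .
  qed
  have "(\<Sum>A\<in>Pow {..<m}. exp (MAX v\<in>F. \<Sum>i<m. if i \<in> A
        then - (c * M.prob (space M - W v (m + i)) - c * M.prob (space M - W v i))
        else c * M.prob (space M - W v (m + i)) - c * M.prob (space M - W v i)))
      \<le> 2 ^ m * (real ((CARD('d) * (2 * m * r + 1)) ^ s) * exp (m * c\<^sup>2 / 2))"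
    by (rule M.sum_Pow_exp_Max_mixture_le[OF F(1,2) _ count c]) (use W in auto)
  moreover have "(\<Sum>i<m. if i \<in> A
        then - (c * e v (z (m + i)) - c * e v (z i)) else c * e v (z (m + i)) - c * e v (z i))
      = (\<Sum>i<m. if i \<in> A
        then - (c * M.prob (space M - W v (m + i)) - c * M.prob (space M - W v i))
        else c * M.prob (space M - W v (m + i)) - c * M.prob (space M - W v i))" for A v
    by (rule sum.cong) (auto simp: e_W)
  ultimately show ?thesis by (simp only:)
qed

section \<open>Tail bound on finite sets and passage to all sparse vectors\<close>

text \<open>The softmax denominator is positive when the label is available; otherwise the error is
  constantly 1. This continuity carries the bound from a countable dense set to all sparse
  vectors.\<close>

lemma tendsto_err:
  assumes "finite (Y (fst p))" "X \<longlonglongrightarrow> v"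
  shows "(\<lambda>n. err Y \<phi> 1 (X n) p) \<longlonglongrightarrow> err Y \<phi> 1 v p"
proof (cases "snd p \<in> Y (fst p)")
  case True
  then have "(\<Sum>y'\<in>Y (fst p). exp (\<phi> (fst p) y' \<bullet> v)) > 0"
    using assms(1) by (intro sum_pos) auto
  then have "(\<lambda>n. 1 - exp (\<phi> (fst p) (snd p) \<bullet> X n) / (\<Sum>y'\<in>Y (fst p). exp (\<phi> (fst p) y' \<bullet> X n)))
      \<longlonglongrightarrow> 1 - exp (\<phi> (fst p) (snd p) \<bullet> v) / (\<Sum>y'\<in>Y (fst p). exp (\<phi> (fst p) y' \<bullet> v))"
    using assms(2) by (intro tendsto_intros) auto
  then show ?thesis using True by (simp add: err_def pred_prob_def)
qed (simp add: err_def pred_prob_def)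

text \<open>Markov's inequality for \<open>exp (h S)\<close> at level
  \<open>exp (m * \<epsilon>\<^sup>2)\<close>; the moment bound consumes half of that
  exponent.\<close>

lemma prob_Ex_deviation_finite_le:
  fixes Y :: "'x \<Rightarrow> 'y set" and \<phi> :: "'x \<Rightarrow> 'y \<Rightarrow> real^'d::finite" and D :: "('x \<times> 'y) measure" and \<epsilon> :: real
  assumes Y_fin: "\<And>x. finite (Y x)" and Y_card: "\<And>x. card (Y x) \<le> r"
    and D: "prob_space D" and meas: "\<And>v. err Y \<phi> 1 v \<in> borel_measurable D"
    and F: "finite F" "F \<noteq> {}" "F \<subseteq> sparse_vecs s" and \<epsilon>: "\<epsilon> \<ge> 0" and m: "m \<ge> 1"
  shows "measure (Pi\<^sub>M {..<m} (\<lambda>_. D))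
      {S \<in> space (Pi\<^sub>M {..<m} (\<lambda>_. D)). \<exists>v\<in>F. \<epsilon> < pop_loss Y \<phi> 1 v D - emp_loss Y \<phi> 1 v m S}
    \<le> real ((CARD('d) * (2 * m * r + 1)) ^ s) * exp (- (m * \<epsilon>\<^sup>2 / 2))"
proof -
  define P where "P = Pi\<^sub>M {..<m} (\<lambda>_. D)"
  interpret P: prob_space P unfolding P_def by (intro prob_space_PiM D)
  interpret D: prob_space D by fact
  define K where "K = real ((CARD('d) * (2 * m * r + 1)) ^ s)"
  \<comment> \<open>The exponential parameter is built into \<open>f\<close>. The choice
    \<open>\<epsilon>\<close> minimises \<open>m * t\<^sup>2 / 2 - m * t * \<epsilon>\<close> over
    \<open>t\<close>.\<close>
  define f where "f v p = \<epsilon> * err Y \<phi> 1 v p" for v p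
  have f_meas: "f v \<in> borel_measurable D" for v
    unfolding f_def using meas by (intro borel_measurable_times borel_measurable_const)
  have f_range: "0 \<le> f v p" "f v p \<le> \<epsilon>" for v p
    using err_bounds[of Y \<phi> 1 v p] Y_fin \<epsilon> by (simp_all add: f_def mult_left_le)
  define h where "h S = (MAX v\<in>F. \<Sum>i<m. (\<integral>p. f v p \<partial>D) - f v (S i))" for S
  have comp: "(\<lambda>S. f v (S i)) \<in> borel_measurable P" if "i < m" for v i
    unfolding P_def by (rule measurable_compose[OF measurable_component_singleton[where M = "\<lambda>_. D"] f_meas]) (use that in simp)
  have Ef: "0 \<le> (\<integral>p. f v p \<partial>D)" "(\<integral>p. f v p \<partial>D) \<le> \<epsilon>" for v
  proof -
    show "0 \<le> (\<integral>p. f v p \<partial>D)" using f_range by (intro integral_nonneg_AE) auto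
    have "(\<integral>p. f v p \<partial>D) \<le> (\<integral>p. \<epsilon> \<partial>D)"
      using f_range f_meas \<epsilon> by (intro integral_mono D.integrable_const_bound[where B = \<epsilon>]) auto
    then show "(\<integral>p. f v p \<partial>D) \<le> \<epsilon>" by (simp add: D.prob_space)
  qed
  have int: "integrable P (\<lambda>S. exp (h S))"
    unfolding h_def
  proof (rule P.integrable_exp_Max[OF F(1,2), where B = "real m * \<epsilon>"])
    fix v
    show "(\<lambda>S. \<Sum>i<m. (\<integral>p. f v p \<partial>D) - f v (S i)) \<in> borel_measurable P"
      by (intro borel_measurable_sum borel_measurable_diff borel_measurable_const comp) auto
    have "\<bar>(\<integral>p. f v p \<partial>D) - f v p\<bar> \<le> \<epsilon>" for p
      using Ef[of v] f_range[of v p] by linarith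
    then show "\<bar>\<Sum>i<m. (\<integral>p. f v p \<partial>D) - f v (S i)\<bar> \<le> real m * \<epsilon>" for S
      using sum_norm_bound[of "{..<m}" "\<lambda>i. (\<integral>p. f v p \<partial>D) - f v (S i)" \<epsilon>] by simp
  qed
  have mgf: "(\<integral>S. exp (h S) \<partial>P) \<le> K * exp (m * \<epsilon>\<^sup>2 / 2)"
    unfolding h_def P_def
  proof (rule exp_Max_deviation_le_symmetrized[OF D F(1,2) f_meas, where B = \<epsilon>])
    show "\<bar>f v x\<bar> \<le> \<epsilon>" for v x using f_range[of v x] by simp
    show "(\<Sum>A\<in>Pow {..<m}. exp (MAX v\<in>F. \<Sum>i<m. if i \<in> A
        then - (f v (z (m + i)) - f v (z i)) else f v (z (m + i)) - f v (z i)))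
        \<le> 2 ^ m * (K * exp (m * \<epsilon>\<^sup>2 / 2))" for z
      unfolding f_def K_def by (rule sum_Pow_exp_Max_err_le[OF Y_fin Y_card F \<epsilon>])
  qed
  have "P.prob {S \<in> space P. \<exists>v\<in>F. \<epsilon> < pop_loss Y \<phi> 1 v D - emp_loss Y \<phi> 1 v m S}
      \<le> P.prob {S \<in> space P. exp (h S) \<ge> exp (m * \<epsilon>\<^sup>2)}"
  proof (rule P.finite_measure_mono)
    have "(\<lambda>S. exp (h S)) \<in> borel_measurable P" using int by auto
    then show "{S \<in> space P. exp (h S) \<ge> exp (m * \<epsilon>\<^sup>2)} \<in> P.events" by measurable
    show "{S \<in> space P. \<exists>v\<in>F. \<epsilon> < pop_loss Y \<phi> 1 v D - emp_loss Y \<phi> 1 v m S}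
        \<subseteq> {S \<in> space P. exp (h S) \<ge> exp (m * \<epsilon>\<^sup>2)}"
    proof
      fix S assume "S \<in> {S \<in> space P. \<exists>v\<in>F. \<epsilon> < pop_loss Y \<phi> 1 v D - emp_loss Y \<phi> 1 v m S}"
      then obtain v where S: "S \<in> space P" and v: "v \<in> F"
        and dev: "\<epsilon> < pop_loss Y \<phi> 1 v D - emp_loss Y \<phi> 1 v m S" by blast
      have "m * \<epsilon>\<^sup>2 = m * \<epsilon> * \<epsilon>" by (simp add: power2_eq_square)
      also have "\<dots> \<le> m * \<epsilon> * (pop_loss Y \<phi> 1 v D - emp_loss Y \<phi> 1 v m S)"
        using dev \<epsilon> by (intro mult_left_mono) auto
      also have "\<dots> = (\<Sum>i<m. (\<integral>p. f v p \<partial>D) - f v (S i))"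
        using m by (simp add: sum_subtractf f_def pop_loss_def emp_loss_def sum_distrib_left algebra_simps)
      also have "\<dots> \<le> h S" unfolding h_def using v F by (intro Max_ge) auto
      finally show "S \<in> {S \<in> space P. exp (h S) \<ge> exp (m * \<epsilon>\<^sup>2)}" using S by simp
    qed
  qed
  also have "\<dots> \<le> (\<integral>S. exp (h S) \<partial>P) / exp (m * \<epsilon>\<^sup>2)"
    by (rule integral_Markov_inequality_measure[OF int, of "{}"]) auto
  also have "\<dots> \<le> K * exp (m * \<epsilon>\<^sup>2 / 2) / exp (m * \<epsilon>\<^sup>2)"
    using mgf by (intro divide_right_mono) auto
  also have "\<dots> = K * exp (- (m * \<epsilon>\<^sup>2 / 2))"
    by (simp add: field_simps flip: exp_diff exp_add)
  finally show ?thesis by (simp add: P_def K_def)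
qed

text \<open>Enumerating a countable dense subset yields increasing bad events \<open>U n\<close>,
  all obeying the bound for finite sets. The complement of their union is measurable by
  construction, and the non-strict inequality passes to limits.\<close>

lemma uniform_deviation_sparse:
  fixes Y :: "'x \<Rightarrow> 'y set" and \<phi> :: "'x \<Rightarrow> 'y \<Rightarrow> real^'d::finite" and D :: "('x \<times> 'y) measure" and \<epsilon> :: real
  assumes Y_fin: "\<And>x. finite (Y x)" and Y_card: "\<And>x. card (Y x) \<le> r"
    and D: "prob_space D" and meas: "\<And>v. err Y \<phi> 1 v \<in> borel_measurable D"
    and \<epsilon>: "\<epsilon> \<ge> 0" and m: "m \<ge> 1"
  obtains E where "E \<in> sets (Pi\<^sub>M {..<m} (\<lambda>_. D))"
    "measure (Pi\<^sub>M {..<m} (\<lambda>_. D)) E \<ge> 1 - real ((CARD('d) * (2 * m * r + 1)) ^ s) * exp (- (m * \<epsilon>\<^sup>2 / 2))"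
    "\<And>S v. S \<in> E \<Longrightarrow> v \<in> sparse_vecs s \<Longrightarrow> pop_loss Y \<phi> 1 v D \<le> emp_loss Y \<phi> 1 v m S + \<epsilon>"
proof -
  define P where "P = Pi\<^sub>M {..<m} (\<lambda>_. D)"
  interpret P: prob_space P unfolding P_def by (intro prob_space_PiM D)
  interpret D: prob_space D by fact
  define C where "C = real ((CARD('d) * (2 * m * r + 1)) ^ s) * exp (- (m * \<epsilon>\<^sup>2 / 2))"
  define dev where "dev v S = pop_loss Y \<phi> 1 v D - emp_loss Y \<phi> 1 v m S" for v S
  have dev_meas: "dev v \<in> borel_measurable P" for v
    unfolding dev_def emp_loss_def P_def
    by (intro borel_measurable_diff borel_measurable_const borel_measurable_times borel_measurable_sum
        measurable_compose[OF measurable_component_singleton[where M = "\<lambda>_. D"] meas]) auto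
  \<comment> \<open>Separability is applied to the set of sparse vectors itself, so that the
    approximating vectors are sparse and the pattern count applies to them.\<close>
  obtain Q :: "(real^'d) set" where Q: "countable Q" "Q \<subseteq> sparse_vecs s" "sparse_vecs s \<subseteq> closure Q"
    using separable[of "sparse_vecs s"] .
  have "0 \<in> (sparse_vecs s :: (real^'d) set)" by (simp add: sparse_vecs_def)
  with Q have Q_ne: "Q \<noteq> {}" by auto
  define q where "q = from_nat_into Q"
  have q: "range q = Q" unfolding q_def using Q(1) Q_ne by (rule range_from_nat_into[rotated])
  define U where "U n = {S \<in> space P. \<exists>v\<in>q ` {..n}. \<epsilon> < dev v S}" for n :: nat
  have U: "U n \<in> P.events" for n
    unfolding U_def using dev_meas
    by (intro sets.sets_Collect_finite_Ex borel_measurable_less borel_measurable_const) auto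
  have "P.prob (U n) \<le> C" for n
    unfolding U_def P_def C_def dev_def
    using Q(2) q by (intro prob_Ex_deviation_finite_le assms) auto
  moreover have "(\<lambda>n. P.prob (U n)) \<longlonglongrightarrow> P.prob (\<Union>n. U n)"
    using U by (intro P.finite_Lim_measure_incseq) (force simp: incseq_def U_def)+
  ultimately have bad: "P.prob (\<Union>n. U n) \<le> C"
    by (intro LIMSEQ_le_const2) auto
  define E where "E = space P - (\<Union>n. U n)"
  have E: "E \<in> P.events" unfolding E_def using U by auto
  show thesis
  proof (rule that)
    show "E \<in> sets (Pi\<^sub>M {..<m} (\<lambda>_. D))" using E by (simp add: P_def)
    have "P.prob E = 1 - P.prob (\<Union>n. U n)"
      unfolding E_def using U by (intro P.prob_compl) auto
    then show "measure (Pi\<^sub>M {..<m} (\<lambda>_. D)) E \<ge> 1 - real ((CARD('d) * (2 * m * r + 1)) ^ s) * exp (- (m * \<epsilon>\<^sup>2 / 2))"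
      using bad by (simp add: P_def C_def)
  next
    fix S :: "nat \<Rightarrow> 'x \<times> 'y" and v :: "real^'d" assume S: "S \<in> E" and v: "v \<in> sparse_vecs s"
    have le: "dev w S \<le> \<epsilon>" if "w \<in> Q" for w
    proof -
      have "w \<in> range q" using that q by simp
      then obtain n where "w = q n" by blast
      then show ?thesis using S by (force simp: E_def U_def not_less)
    qed
    obtain X where X: "\<And>n. X n \<in> Q" "X \<longlonglongrightarrow> v"
      using v Q(3) closure_sequential by blast
    have "(\<lambda>n. dev (X n) S) \<longlonglongrightarrow> dev v S"
      unfolding dev_def
    proof (rule tendsto_diff)
      show "(\<lambda>n. pop_loss Y \<phi> 1 (X n) D) \<longlonglongrightarrow> pop_loss Y \<phi> 1 v D"
        unfolding pop_loss_def
      proof (rule integral_dominated_convergence[where w = "\<lambda>_. 1"])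
        show "AE p in D. (\<lambda>n. err Y \<phi> 1 (X n) p) \<longlonglongrightarrow> err Y \<phi> 1 v p"
          by (intro AE_I2 tendsto_err Y_fin X(2))
        show "AE p in D. norm (err Y \<phi> 1 (X n) p) \<le> 1" for n
          using err_bounds(3)[of Y] Y_fin by (intro AE_I2) simp
      qed (use meas in auto)
      show "(\<lambda>n. emp_loss Y \<phi> 1 (X n) m S) \<longlonglongrightarrow> emp_loss Y \<phi> 1 v m S"
        unfolding emp_loss_def by (intro tendsto_intros tendsto_err Y_fin X(2))
    qed
    then have "dev v S \<le> \<epsilon>"
      by (rule LIMSEQ_le_const2) (use le X in auto)
    then show "pop_loss Y \<phi> 1 v D \<le> emp_loss Y \<phi> 1 v m S + \<epsilon>" by (simp add: dev_def)
  qed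
qed

section \<open>Rescaling and the numerical form of the bound\<close>

lemma sparse_vecs_scaleR:
  assumes "w \<in> sparse_vecs s"
  shows "c *\<^sub>R w \<in> sparse_vecs s"
proof -
  have "card {i. (c *\<^sub>R w) $ i \<noteq> 0} \<le> card {i. w $ i \<noteq> 0}"
    by (intro card_mono) auto
  with assms show ?thesis by (simp add: sparse_vecs_def)
qed

text \<open>With \<open>\<epsilon> = a + b\<close>, use
  \<open>\<epsilon>\<^sup>2 \<ge> a\<^sup>2 + b\<^sup>2\<close>: the part \<open>a\<close>
  contributes \<open>2 * (s * L)\<close> to the exponent, which absorbs the pattern count, and
  \<open>b\<close> contributes \<open>9 / 4 * ln (2 / \<delta>)\<close>, more than enough for
  \<open>\<delta> / 2\<close>.\<close>

lemma pattern_bound_mult_exp_le: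
  fixes d m r s :: nat and \<delta> \<epsilon> :: real
  assumes d: "d \<ge> 1" and m: "m \<ge> 2" and r: "r \<ge> 1" and \<delta>: "0 < \<delta>" "\<delta> < 1"
  defines "\<epsilon> \<equiv> 2 * sqrt (real s * (ln (real d) + 2 * ln (real m * real r)) / real m)
      + 3 * sqrt (ln (2 / \<delta>) / (2 * real m))"
  shows "real ((d * (2 * m * r + 1)) ^ s) * exp (- (m * \<epsilon>\<^sup>2 / 2)) \<le> \<delta>"
proof -
  define k where "k = real m * real r"
  define L where "L = ln (real d) + 2 * ln k"
  have k: "k \<ge> 2" unfolding k_def using mult_mono[of 2 "real m" 1 "real r"] m r by simp
  have L: "L \<ge> 0" unfolding L_def using d k by simp
  have T: "ln (2 / \<delta>) \<ge> 0" using \<delta> by simp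
  define a where "a = 2 * sqrt (real s * L / real m)"
  define b where "b = 3 * sqrt (ln (2 / \<delta>) / (2 * real m))"
  have ab: "a \<ge> 0" "b \<ge> 0" using L T by (auto simp: a_def b_def)
  have "a\<^sup>2 = 4 * (real s * L / real m)" "b\<^sup>2 = 9 * (ln (2 / \<delta>) / (2 * real m))"
    using L T by (auto simp: a_def b_def power_mult_distrib)
  then have "real m * (a\<^sup>2 + b\<^sup>2) / 2 = 2 * (real s * L) + 9 / 4 * ln (2 / \<delta>)"
    using m by (simp add: field_simps)
  moreover have "a\<^sup>2 + b\<^sup>2 \<le> \<epsilon>\<^sup>2"
    using ab by (simp add: \<epsilon>_def a_def b_def L_def k_def power2_sum)
  ultimately have exponent: "real m * \<epsilon>\<^sup>2 / 2 \<ge> 2 * (real s * L) + ln (2 / \<delta>)"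
    using T m mult_left_mono[of "a\<^sup>2 + b\<^sup>2" "\<epsilon>\<^sup>2" "real m"] by simp
  \<comment> \<open>From \<open>k \<ge> 2\<close> follows \<open>2 * k + 1 \<le> k ^ 4\<close>, so
    the cell factor has logarithm at most \<open>4 * ln k\<close>, exactly the share of
    \<open>ln k\<close> in \<open>2 * L\<close>.\<close>
  have "2 * k + 1 \<le> 8 * k" using k by simp
  also have "\<dots> \<le> k ^ 3 * k"
    using k power_mono[of 2 k 3] by (intro mult_right_mono) auto
  also have "\<dots> = k ^ 4" by (simp add: eval_nat_numeral)
  finally have "ln (2 * k + 1) \<le> 4 * ln k"
    using k by (subst (asm) ln_le_cancel_iff[symmetric]) (auto simp: ln_realpow)
  moreover have "ln (real d * (2 * k + 1)) = ln (real d) + ln (2 * k + 1)"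
    using d k by (simp add: ln_mult)
  moreover have "ln (real d) \<ge> 0" using d by simp
  ultimately have "ln (real d * (2 * k + 1)) \<le> 2 * L" by (simp add: L_def)
  then have "exp (ln (real d * (2 * k + 1))) \<le> exp (2 * L)" by simp
  moreover have pos: "real d * (2 * k + 1) > 0" using d k by (intro mult_pos_pos) auto
  ultimately have "(real d * (2 * k + 1)) ^ s \<le> exp (2 * L) ^ s"
    by (intro power_mono) (simp_all only: exp_ln less_imp_le)
  also have "\<dots> = exp (2 * (real s * L))"
    by (simp add: mult_ac flip: exp_of_nat_mult)
  finally have "real ((d * (2 * m * r + 1)) ^ s) \<le> exp (2 * (real s * L))"
    by (simp add: k_def algebra_simps)
  then have "real ((d * (2 * m * r + 1)) ^ s) * exp (- (m * \<epsilon>\<^sup>2 / 2))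
      \<le> exp (2 * (real s * L)) * exp (- (2 * (real s * L) + ln (2 / \<delta>)))"
    using exponent by (intro mult_mono) auto
  also have "\<dots> = exp (- ln (2 / \<delta>))" by (simp flip: exp_add)
  also have "\<dots> = \<delta> / 2" using \<delta> by (simp add: exp_minus)
  also have "\<dots> \<le> \<delta>" using \<delta> by simp
  finally show ?thesis .
qed

theorem theorem1:
  fixes Y :: "'x \<Rightarrow> 'y set"
    and \<phi> :: "'x \<Rightarrow> 'y \<Rightarrow> real^'d::finite"
    and r s m :: nat
    and \<delta> :: real
    and \<beta> :: "nat \<Rightarrow> real^'d \<Rightarrow> real"
    and D :: "('x \<times> 'y) measure"
  assumes Y_fin: "\<And>x. finite (Y x)"
    and Y_ne: "\<And>x. Y x \<noteq> {}"
    and Y_card: "\<And>x. card (Y x) \<le> r"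
    and \<phi>_coord: "\<And>x y i. y \<in> Y x \<Longrightarrow> \<phi> x y $ i \<noteq> 0 \<Longrightarrow> \<phi> x y $ i \<ge> 1"
    and D_prob: "prob_space D"
    and D_supp: "AE p in D. snd p \<in> Y (fst p)"
    and err_meas: "\<And>b w. b > 0 \<Longrightarrow> err Y \<phi> b w \<in> borel_measurable D"
    and m_pos: "m \<ge> 1"
    and \<delta>_pos: "0 < \<delta>" and \<delta>_lt: "\<delta> < 1"
    and \<beta>_pos: "\<And>w. \<beta> m w > 0"
  shows "\<exists>E \<in> sets (PiM {..<m} (\<lambda>_. D)).
           measure (PiM {..<m} (\<lambda>_. D)) E \<ge> 1 - \<delta> \<and>
           (\<forall>S \<in> E. \<forall>w \<in> sparse_vecs s.
              pop_loss Y \<phi> (\<beta> m w) w D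
                \<le> emp_loss Y \<phi> (\<beta> m w) w m S
                   + 2 * sqrt (real s * (ln (real CARD('d)) + 2 * ln (real m * real r)) / real m)
                   + 3 * sqrt (ln (2 / \<delta>) / (2 * real m)))"
proof -
  define P where "P = Pi\<^sub>M {..<m} (\<lambda>_. D)"
  interpret P: prob_space P unfolding P_def by (intro prob_space_PiM D_prob)
  interpret D: prob_space D by fact
  define a where "a = 2 * sqrt (real s * (ln (real CARD('d)) + 2 * ln (real m * real r)) / real m)"
  define b where "b = 3 * sqrt (ln (2 / \<delta>) / (2 * real m))"
  \<comment> \<open>\<open>undefined\<close> serves as an arbitrary input, whose nonempty label set
    forces \<open>r \<ge> 1\<close>. This makes \<open>ln (m * r)\<close> and the argument of the
    first square root nonnegative.\<close>
  have r: "r \<ge> 1"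
    using Y_card[of undefined] Y_fin[of undefined] Y_ne[of undefined]
    by (metis card_gt_0_iff less_one linorder_not_less order_less_le_trans)
  have "real m * real r \<ge> 1" using r m_pos mult_mono[of 1 "real m" 1 "real r"] by simp
  then have a: "a \<ge> 0" by (simp add: a_def)
  have b: "b \<ge> 0" using \<delta>_pos \<delta>_lt by (simp add: b_def)
  have meas: "err Y \<phi> 1 v \<in> borel_measurable D" for v by (rule err_meas) simp
  have "\<exists>E \<in> sets P. P.prob E \<ge> 1 - \<delta> \<and>
      (\<forall>S\<in>E. \<forall>v\<in>sparse_vecs s. pop_loss Y \<phi> 1 v D \<le> emp_loss Y \<phi> 1 v m S + (a + b))"
  \<comment> \<open>For \<open>m = 1\<close> the product \<open>m * r\<close> may be 1, where
    \<open>2 * k + 1 \<le> k ^ 4\<close> fails. But then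
    \<open>b\<^sup>2 = 9 / 2 * ln (2 / \<delta>) \<ge> 3\<close>, so \<open>b \<ge> 1\<close> and
    the bound is trivial, with the whole space as event.\<close>
  proof (cases "m = 1")
    case True
    have "b \<ge> 1"
    proof -
      have "ln 2 \<le> ln (2 / \<delta>)" using \<delta>_pos \<delta>_lt by (simp add: field_simps)
      then have "1 \<le> 9 * (ln (2 / \<delta>) / 2)" using ln2_ge_two_thirds by simp
      also have "\<dots> = b\<^sup>2"
        using \<delta>_pos \<delta>_lt True by (simp add: b_def power_mult_distrib)
      finally have "1\<^sup>2 \<le> b\<^sup>2" by simp
      then show ?thesis using b by (rule power2_le_imp_le)
    qed
    have "pop_loss Y \<phi> 1 v D \<le> emp_loss Y \<phi> 1 v m S + (a + b)" for v S
    proof -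
      have "pop_loss Y \<phi> 1 v D \<le> (\<integral>p. 1 \<partial>D)"
        unfolding pop_loss_def using err_bounds[of Y] Y_fin meas
        by (intro integral_mono D.integrable_const_bound[where B = 1] AE_I2) simp_all
      moreover have "emp_loss Y \<phi> 1 v m S \<ge> 0"
        unfolding emp_loss_def using err_bounds[of Y] Y_fin by (intro mult_nonneg_nonneg sum_nonneg) simp_all
      ultimately show ?thesis using a \<open>b \<ge> 1\<close> by (simp add: D.prob_space)
    qed
    then show ?thesis
      using \<delta>_pos by (intro bexI[of _ "space P"]) (auto simp: P.prob_space)
  next
    case False
    then have m: "m \<ge> 2" using m_pos by simp
    obtain E where E: "E \<in> sets P"
      "P.prob E \<ge> 1 - real ((CARD('d) * (2 * m * r + 1)) ^ s) * exp (- (m * (a + b)\<^sup>2 / 2))"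
      "\<And>S v. S \<in> E \<Longrightarrow> v \<in> sparse_vecs s \<Longrightarrow> pop_loss Y \<phi> 1 v D \<le> emp_loss Y \<phi> 1 v m S + (a + b)"
      unfolding P_def
      using uniform_deviation_sparse[OF Y_fin Y_card D_prob meas, of "a + b" m s] a b m_pos by auto
    have "real ((CARD('d) * (2 * m * r + 1)) ^ s) * exp (- (m * (a + b)\<^sup>2 / 2)) \<le> \<delta>"
      unfolding a_def b_def using m r \<delta>_pos \<delta>_lt by (intro pattern_bound_mult_exp_le) (auto simp: Suc_le_eq)
    then show ?thesis using E by (intro bexI[of _ E]) auto
  qed
  then obtain E where E: "E \<in> sets P" "P.prob E \<ge> 1 - \<delta>"
    "\<And>S v. S \<in> E \<Longrightarrow> v \<in> sparse_vecs s \<Longrightarrow> pop_loss Y \<phi> 1 v D \<le> emp_loss Y \<phi> 1 v m S + (a + b)"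
    by blast
  \<comment> \<open>At scale \<open>\<beta> m w\<close> the losses of \<open>w\<close> are those of
    the sparse vector \<open>w /\<^sub>R \<beta> m w\<close> at scale 1. Since the bound on
    \<open>E\<close> is uniform in \<open>v\<close>, the scale may vary arbitrarily with
    \<open>w\<close>.\<close>
  have "pop_loss Y \<phi> (\<beta> m w) w D \<le> emp_loss Y \<phi> (\<beta> m w) w m S + a + b"
    if "S \<in> E" "w \<in> sparse_vecs s" for S w
    using E(3)[OF that(1) sparse_vecs_scaleR[OF that(2)], of "inverse (\<beta> m w)"]
    by (simp add: pop_loss_def emp_loss_def err_rescale[of Y \<phi> "\<beta> m w" w])
  with E(1,2) show ?thesis
    by (intro bexI[of _ E]) (auto simp: P_def a_def b_def)
qed

end
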